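(* Let $T>0$, let $\mu$ be a finite measure on $([0,T],\mathcal{B}or([0,T]))$ and let $p\in[1,+\infty)$. Let $X=(X_t)_{t\in[0,T]}$ be a real-valued càdlàg process with independent increments such that, for every $u\in\mathbb{R}$, $t\mapsto L(u,t)=\mathbb{E}\,e^{uX_t}$ is bounded and bounded away from $0$ over $[0,T]$, so that, in particular, $\Psi(u,t)=\log\mathbb{E}\,e^{uX_t}$ can be defined as a real-valued function. Let $F:L^p([0,T],\mu)\to\mathbb{R}$ be a measurable functional, regularly differentiable with a monotone gradient $\nabla F$ on $\mathbb{D}([0,T],\mathbb{R})$, and satisfying, for some real constant $[F]_{\rm Lip}$, $$\forall\,\alpha,\beta\in\mathbb{D}([0,T],\mathbb{R}),\quad|F(\alpha)-F(\beta)|\le[F]_{\rm Lip}\,\|\alpha-\beta\|_{L^p([0,T],\mu)}.$$ Set, for every $\sigma>0$, $$f(\sigma)=\mathbb{E}\Big(F\big(e^{\sigma X_\cdot-\Psi(\sigma,\cdot)}\big)\Big).$$ Then the function $f$ is (differentiable and) non-decreasing.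
   Context: $\mathbb{D}([0,T],\mathbb{R})$ is the space of càdlàg (right continuous with left limits) functions on $[0,T]$, $\mathcal{D}_T$ the $\sigma$-field generated by the evaluations $\alpha\mapsto\alpha(t)$, $\mathcal{B}or([0,T])$ is the Borel $\sigma$-field of $[0,T]$, and $q$ is the Hölder conjugate of $p$. A process with independent increments is a process such that $X_t-X_s$ is independent of $\sigma(X_u,\,u\le s)$ for all $s\le t$. A measurable functional $F:L^p([0,T],\mu)\to\mathbb{R}$ is regularly differentiable on $\mathbb{D}([0,T],\mathbb{R})$ if there exists a measurable "gradient" functional $\nabla F:([0,T]\times\mathbb{D}([0,T],\mathbb{R}),\mathcal{B}or([0,T])\otimes\mathcal{D}_T)\to\mathbb{R}$ such that, for every $\alpha\in\mathbb{D}([0,T],\mathbb{R})$: (i) $\nabla F(\cdot,\alpha)\in L^q([0,T],\mu)$; (ii) $\dfrac{\big|F(\alpha+h)-F(\alpha)-\int_0^T\nabla F(s,\alpha)h(s)\,\mu(ds)\big|}{\|h\|_{L^p([0,T],\mu)}}\to0$ as $\|h\|_{L^p([0,T],\mu)}\to0$, $h\in L^p([0,T],\mu)$. The gradient $\nabla F$ is monotone if, for every $t\in[0,T]$, $\nabla F(t,\cdot)$ is monotone on $\mathbb{D}([0,T],\mathbb{R})$ (that is, either non-decreasing or non-increasing for the pointwise order, where $\alpha\le\beta$ if $\alpha(s)\le\beta(s)$ for all $s\in[0,T]$) and if this monotony does not depend on $t\in[0,T]$.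
   Formalization: That f is non-decreasing is stated only when ∇F is non-decreasing; when ∇F is non-increasing, f is shown to be non-increasing instead, since the printed claim fails there (e.g. F(h) = −√(1+h(0)²), μ the Dirac mass at 0, X constant in time equal to ±1). *)

theory Defs
  imports "HOL-Probability.Probability"
begin

text \<open>
  Elements of \<open>L\<^sup>p\<close> are represented by functions, not by classes modulo almost
  everywhere equality; \<open>Lp_norm\<close> is therefore only a seminorm. In the theorem the
  measure \<open>\<mu>\<close> has space \<open>{0..T}\<close>, so values outside \<open>{0..T}\<close> play no role.
\<close>

definition Lp :: "'a measure \<Rightarrow> real \<Rightarrow> ('a \<Rightarrow> real) set" where
  "Lp \<mu> p = {h \<in> borel_measurable \<mu>. integrable \<mu> (\<lambda>s. \<bar>h s\<bar> powr p)}"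

definition Lp_norm :: "'a measure \<Rightarrow> real \<Rightarrow> ('a \<Rightarrow> real) \<Rightarrow> real" where
  "Lp_norm \<mu> p h = (\<integral>s. \<bar>h s\<bar> powr p \<partial>\<mu>) powr (1 / p)"

text \<open>The space \<open>L\<^sup>q\<close> for the Hoelder conjugate \<open>q\<close> of \<open>p \<ge> 1\<close>; for \<open>p = 1\<close> this is
  the space of essentially bounded functions.\<close>

definition Lp_conj :: "'a measure \<Rightarrow> real \<Rightarrow> ('a \<Rightarrow> real) set" where
  "Lp_conj \<mu> p =
    (if p = 1 then {g \<in> borel_measurable \<mu>. \<exists>C. AE s in \<mu>. \<bar>g s\<bar> \<le> C}
     else Lp \<mu> (p / (p - 1)))"

text \<open>The Borel \<open>\<sigma>\<close>-field of \<open>L\<^sup>p\<close>. Sets that are open for the seminorm are unions of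
  classes modulo almost everywhere equality, hence so are all measurable sets, and a real
  function measurable for \<open>Lp_borel\<close> takes the same value on functions that are equal
  almost everywhere: it is a function on the quotient.\<close>

definition Lp_open :: "'a measure \<Rightarrow> real \<Rightarrow> ('a \<Rightarrow> real) set \<Rightarrow> bool" where
  "Lp_open \<mu> p U \<longleftrightarrow> U \<subseteq> Lp \<mu> p \<and>
    (\<forall>g\<in>U. \<exists>\<epsilon>>0. \<forall>h\<in>Lp \<mu> p. Lp_norm \<mu> p (\<lambda>s. h s - g s) < \<epsilon> \<longrightarrow> h \<in> U)"

definition Lp_borel :: "'a measure \<Rightarrow> real \<Rightarrow> ('a \<Rightarrow> real) measure" where
  "Lp_borel \<mu> p = sigma (Lp \<mu> p) {U. Lp_open \<mu> p U}"

text \<open>The filter of \<open>h \<in> L\<^sup>p\<close> with \<open>\<parallel>h\<parallel> \<rightarrow> 0\<close>, \<open>\<parallel>h\<parallel> \<noteq> 0\<close>.\<close>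

definition Lp_to_zero :: "'a measure \<Rightarrow> real \<Rightarrow> ('a \<Rightarrow> real) filter" where
  "Lp_to_zero \<mu> p = inf (filtercomap (Lp_norm \<mu> p) (at_right 0)) (principal (Lp \<mu> p))"

text \<open>A function on \<open>{0..T}\<close> is represented by a function on the reals whose values outside
  \<open>{0..T}\<close> are arbitrary. The \<open>\<sigma>\<close>-field is generated by the evaluations at points of
  \<open>{0..T}\<close> only, so functionals measurable for it do not depend on the other values.\<close>

definition cadlag :: "real \<Rightarrow> (real \<Rightarrow> real) set" where
  "cadlag T = {\<alpha>. (\<forall>t\<in>{0..<T}. (\<alpha> \<longlongrightarrow> \<alpha> t) (at_right t)) \<and>
                  (\<forall>t\<in>{0<..T}. \<exists>l. (\<alpha> \<longlongrightarrow> l) (at_left t))}"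

definition cadlag_sigma :: "real \<Rightarrow> (real \<Rightarrow> real) measure" where
  "cadlag_sigma T =
    sigma (cadlag T) {{\<alpha> \<in> cadlag T. \<alpha> t \<in> A} | t A. t \<in> {0..T} \<and> A \<in> sets borel}"

definition cadlag_process :: "'w measure \<Rightarrow> real \<Rightarrow> (real \<Rightarrow> 'w \<Rightarrow> real) \<Rightarrow> bool" where
  "cadlag_process M T X \<longleftrightarrow>
    (\<forall>t\<in>{0..T}. X t \<in> borel_measurable M) \<and> (\<forall>\<omega>\<in>space M. (\<lambda>t. X t \<omega>) \<in> cadlag T)"

definition past_events :: "'w measure \<Rightarrow> (real \<Rightarrow> 'w \<Rightarrow> real) \<Rightarrow> real \<Rightarrow> 'w set set" where
  "past_events M X s =
    sigma_sets (space M) {X u -` A \<inter> space M | u A. u \<in> {0..s} \<and> A \<in> sets borel}"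

definition independent_increments ::
    "'w measure \<Rightarrow> real \<Rightarrow> (real \<Rightarrow> 'w \<Rightarrow> real) \<Rightarrow> bool" where
  "independent_increments M T X \<longleftrightarrow>
    (\<forall>s t. 0 \<le> s \<and> s \<le> t \<and> t \<le> T \<longrightarrow>
      prob_space.indep_set M
        {(\<lambda>\<omega>. X t \<omega> - X s \<omega>) -` A \<inter> space M | A. A \<in> sets borel}
        (past_events M X s))"

definition exp_moment :: "'w measure \<Rightarrow> (real \<Rightarrow> 'w \<Rightarrow> real) \<Rightarrow> real \<Rightarrow> real \<Rightarrow> real" where
  "exp_moment M X u t = (\<integral>\<omega>. exp (u * X t \<omega>) \<partial>M)"

definition log_exp_moment :: "'w measure \<Rightarrow> (real \<Rightarrow> 'w \<Rightarrow> real) \<Rightarrow> real \<Rightarrow> real \<Rightarrow> real" where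
  "log_exp_moment M X u t = ln (exp_moment M X u t)"

definition normalized_exp ::
    "'w measure \<Rightarrow> (real \<Rightarrow> 'w \<Rightarrow> real) \<Rightarrow> real \<Rightarrow> 'w \<Rightarrow> real \<Rightarrow> real" where
  "normalized_exp M X \<sigma> \<omega> t = exp (\<sigma> * X t \<omega> - log_exp_moment M X \<sigma> t)"

definition regularly_differentiable ::
    "real measure \<Rightarrow> real \<Rightarrow> real \<Rightarrow> ((real \<Rightarrow> real) \<Rightarrow> real) \<Rightarrow>
      (real \<Rightarrow> (real \<Rightarrow> real) \<Rightarrow> real) \<Rightarrow> bool" where
  "regularly_differentiable \<mu> T p F G \<longleftrightarrow>
    (\<lambda>(s, \<alpha>). G s \<alpha>) \<in> borel_measurable (restrict_space borel {0..T} \<Otimes>\<^sub>M cadlag_sigma T) \<and>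
    (\<forall>\<alpha>\<in>cadlag T.
      (\<lambda>s. G s \<alpha>) \<in> Lp_conj \<mu> p \<and>
      ((\<lambda>h. \<bar>F (\<lambda>s. \<alpha> s + h s) - F \<alpha> - (\<integral>s. G s \<alpha> * h s \<partial>\<mu>)\<bar> / Lp_norm \<mu> p h)
        \<longlongrightarrow> 0) (Lp_to_zero \<mu> p))"

definition nondecreasing_gradient :: "real \<Rightarrow> (real \<Rightarrow> (real \<Rightarrow> real) \<Rightarrow> real) \<Rightarrow> bool" where
  "nondecreasing_gradient T G \<longleftrightarrow>
    (\<forall>t\<in>{0..T}. \<forall>\<alpha>\<in>cadlag T. \<forall>\<beta>\<in>cadlag T. (\<forall>s\<in>{0..T}. \<alpha> s \<le> \<beta> s) \<longrightarrow> G t \<alpha> \<le> G t \<beta>)"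

definition nonincreasing_gradient :: "real \<Rightarrow> (real \<Rightarrow> (real \<Rightarrow> real) \<Rightarrow> real) \<Rightarrow> bool" where
  "nonincreasing_gradient T G \<longleftrightarrow>
    (\<forall>t\<in>{0..T}. \<forall>\<alpha>\<in>cadlag T. \<forall>\<beta>\<in>cadlag T. (\<forall>s\<in>{0..T}. \<alpha> s \<le> \<beta> s) \<longrightarrow> G t \<beta> \<le> G t \<alpha>)"

definition monotone_gradient :: "real \<Rightarrow> (real \<Rightarrow> (real \<Rightarrow> real) \<Rightarrow> real) \<Rightarrow> bool" where
  "monotone_gradient T G \<longleftrightarrow> nondecreasing_gradient T G \<or> nonincreasing_gradient T G"

end

(* Sampling the paths on a finite grid turns F into a function Phi of finitely many products
   W_0 ... W_i of independent factors W_j(sigma) = exp(sigma D_j) / E exp(sigma D_j), where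
   the D_j are increments of X. If the gradient of F is non-decreasing, Phi is convex in each
   single (positive) factor, the others being fixed. For sigma < sigma' the function
   W_j(sigma') - W_j(sigma) of D_j has mean 0 and changes sign once, from - to +, where
   both factors take the same value w. By convexity,
   Phi(W_j(sigma')) - Phi(W_j(sigma)) >= Phi'(w) (W_j(sigma') - W_j(sigma)),
   and the right side has mean 0 because Phi'(w) depends only on the other factors. Hence
   the expectation grows when the parameter of one factor after the other is raised, and
   refining the grid gives the monotonicity of f, since F is Lipschitz and the exponential
   moments of X are bounded. Neither the formula for f' nor a correlation inequality on
   the path space is needed.
   Differentiability is dominated convergence: the difference quotients of F along
   sigma are bounded by a constant times the L^p norm of exp(c |X|). *)

theory Submission
  imports Defs
begin

text \<open>The convexity rests on the sign of the direction. With all factors but one fixed, the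
  sampled path is a line \<open>a + w * b\<close> in path space, where \<open>w\<close> is the free
  factor, \<open>b\<close> carries the other factors of the products that contain it, and
  \<open>a\<close> the products that do not. The derivative of \<open>F\<close> along the line is
  the integral of \<open>G s (a + w * b) * b s\<close>. As \<open>b\<close> is nonnegative, raising
  \<open>w\<close> raises the path pointwise, hence the gradient, hence this integral. Directions of
  mixed sign would break both steps.

  The obstacle in the passage to the limit is that only exponential moments at single times are
  controlled, not those of the supremum of a path, so no dominating function for the sampled values
  of \<open>F\<close> is at hand. They are shown to be bounded in L^2 instead, which on a
  probability space suffices for convergence of the means. Fubini over time and the doubling of the
  parameter under squaring reduce that bound to moments at single times.

  A non-increasing gradient is handled by passing to \<open>- F\<close>.\<close>

section \<open>Limits and derivatives of integrals\<close>

text \<open>The bound compares with the centre only, which is exactly what dominated convergence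
  asks of the difference quotients at \<sigma>. Measurability of \<open>g'\<close> follows because
  it is the pointwise limit of these quotients.\<close>

lemma has_real_derivative_integral:
  fixes g :: "real \<Rightarrow> 'a \<Rightarrow> real"
  assumes "\<delta> > 0"
    and int: "\<And>v. \<bar>v - \<sigma>\<bar> < \<delta> \<Longrightarrow> integrable M (g v)"
    and deriv: "\<And>x. x \<in> space M \<Longrightarrow> ((\<lambda>v. g v x) has_real_derivative g' x) (at \<sigma>)"
    and bound: "\<And>v x. \<bar>v - \<sigma>\<bar> < \<delta> \<Longrightarrow> x \<in> space M \<Longrightarrow> \<bar>g v x - g \<sigma> x\<bar> \<le> \<bar>v - \<sigma>\<bar> * B x"
    and B: "integrable M B"
  shows "((\<lambda>v. \<integral>x. g v x \<partial>M) has_real_derivative (\<integral>x. g' x \<partial>M)) (at \<sigma>)"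
proof -
  have int_\<sigma>: "integrable M (g \<sigma>)" using int[of \<sigma>] \<open>\<delta> > 0\<close> by simp
  have key: "(\<lambda>i. ((\<integral>x. g (S i) x \<partial>M) - (\<integral>x. g \<sigma> x \<partial>M)) / (S i - \<sigma>)) \<longlonglongrightarrow> (\<integral>x. g' x \<partial>M)"
    if S: "\<And>i. S i \<noteq> \<sigma>" "S \<longlonglongrightarrow> \<sigma>" "\<And>i. \<bar>S i - \<sigma>\<bar> < \<delta>" for S :: "nat \<Rightarrow> real"
  proof -
    define q where "q i x = (g (S i) x - g \<sigma> x) / (S i - \<sigma>)" for i x
    have q_int: "integrable M (q i)" for i
      unfolding q_def using int[OF S(3)] int_\<sigma> by auto
    have q_lim: "(\<lambda>i. q i x) \<longlonglongrightarrow> g' x" if "x \<in> space M" for x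
    proof -
      have "((\<lambda>v. (g v x - g \<sigma> x) / (v - \<sigma>)) \<longlongrightarrow> g' x) (at \<sigma>)"
        using deriv[OF that] by (simp add: has_field_derivative_iff)
      then show ?thesis
        using S by (auto simp: tendsto_at_iff_sequentially q_def comp_def)
    qed
    have [measurable]: "q i \<in> borel_measurable M" for i using q_int by auto
    have [measurable]: "g' \<in> borel_measurable M"
      by (rule borel_measurable_LIMSEQ_real[OF q_lim]) auto
    have q_le: "norm (q i x) \<le> B x" if "x \<in> space M" for i x
      using bound[OF S(3)[of i] that] S(1)[of i] by (simp add: q_def abs_divide field_simps)
    have "(\<lambda>i. integral\<^sup>L M (q i)) \<longlonglongrightarrow> integral\<^sup>L M g'"
      by (rule integral_dominated_convergence[OF _ _ B]) (use q_lim q_le in auto)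
    moreover have "integral\<^sup>L M (q i) = ((\<integral>x. g (S i) x \<partial>M) - (\<integral>x. g \<sigma> x \<partial>M)) / (S i - \<sigma>)" for i
      unfolding q_def using int[OF S(3)] int_\<sigma> by simp
    ultimately show ?thesis by simp
  qed
  show "((\<lambda>v. \<integral>x. g v x \<partial>M) has_real_derivative (\<integral>x. g' x \<partial>M)) (at \<sigma>)"
    unfolding has_field_derivative_iff tendsto_at_iff_sequentially comp_def
  proof (intro allI impI)
    fix S assume S: "\<forall>i. S i \<in> UNIV - {\<sigma>}" "S \<longlonglongrightarrow> \<sigma>"
    obtain N where N: "\<And>i. i \<ge> N \<Longrightarrow> \<bar>S i - \<sigma>\<bar> < \<delta>"
      using LIMSEQ_D[OF S(2) \<open>\<delta> > 0\<close>] by auto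
    have "(\<lambda>i. ((\<integral>x. g (S (i + N)) x \<partial>M) - (\<integral>x. g \<sigma> x \<partial>M)) / (S (i + N) - \<sigma>)) \<longlonglongrightarrow> (\<integral>x. g' x \<partial>M)"
      using key[of "\<lambda>i. S (i + N)"] S N by (auto intro: LIMSEQ_ignore_initial_segment)
    then show "(\<lambda>i. ((\<integral>x. g (S i) x \<partial>M) - (\<integral>x. g \<sigma> x \<partial>M)) / (S i - \<sigma>)) \<longlonglongrightarrow> (\<integral>x. g' x \<partial>M)"
      by (rule LIMSEQ_offset)
  qed
qed

text \<open>Cauchy-Schwarz against the constant 1, by expanding a square: with m the total mass and
  c the integral of \<open>g\<close>, the integral of (m g - c)^2 is m times the difference of the
  two sides. Cancelling m requires m > 0, hence the separate case of the null measure.\<close>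

lemma (in finite_measure) square_integral_le:
  fixes g :: "'a \<Rightarrow> real"
  assumes [measurable]: "g \<in> borel_measurable M" and g2: "integrable M (\<lambda>x. (g x)\<^sup>2)"
  shows "integrable M g" and "(\<integral>x. g x \<partial>M)\<^sup>2 \<le> measure M (space M) * (\<integral>x. (g x)\<^sup>2 \<partial>M)"
proof -
  have "\<bar>g x\<bar> \<le> 1 + (g x)\<^sup>2" for x
    using sum_squares_ge_zero[of "\<bar>g x\<bar> - 1" 0] by (simp add: power2_eq_square algebra_simps)
  then show g: "integrable M g"
    by (intro Bochner_Integration.integrable_bound[OF Bochner_Integration.integrable_add[OF integrable_const[of 1] g2]]) auto
  let ?m = "measure M (space M)"
  show "(\<integral>x. g x \<partial>M)\<^sup>2 \<le> ?m * (\<integral>x. (g x)\<^sup>2 \<partial>M)"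
  proof (cases "?m = 0")
    case True
    then have "AE x in M. False"
      by (intro AE_I[of _ _ "space M"]) (auto simp: emeasure_eq_measure)
    then have "AE x in M. g x = 0" by eventually_elim simp
    then have "(\<integral>x. g x \<partial>M) = 0"
      by (simp add: integral_eq_zero_AE)
    then show ?thesis using True by simp
  next
    case False
    then have m: "?m > 0" by (simp add: zero_less_measure_iff measure_nonneg less_le)
    let ?c = "\<integral>x. g x \<partial>M"
    have "0 \<le> (\<integral>x. (?m * g x - ?c)\<^sup>2 \<partial>M)" by simp
    also have "(\<integral>x. (?m * g x - ?c)\<^sup>2 \<partial>M) = (\<integral>x. ?m\<^sup>2 * (g x)\<^sup>2 - 2 * ?m * ?c * g x + ?c\<^sup>2 \<partial>M)"
      by (intro Bochner_Integration.integral_cong) (auto simp: power2_eq_square algebra_simps)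
    also have "\<dots> = ?m\<^sup>2 * (\<integral>x. (g x)\<^sup>2 \<partial>M) - 2 * ?m * ?c * ?c + ?c\<^sup>2 * ?m"
      using g g2 by simp
    also have "\<dots> = ?m * (?m * (\<integral>x. (g x)\<^sup>2 \<partial>M) - ?c\<^sup>2)"
      by (simp add: power2_eq_square algebra_simps)
    finally show ?thesis using m by (simp add: zero_le_mult_iff)
  qed
qed

text \<open>A bound in L^2 makes the sequence uniformly integrable, so pointwise convergence passes
  to the integrals without a dominating function. Fatou's lemma gives the limit the same L^2 bound;
  the differences are then truncated at a level \<open>K\<close>, with dominated convergence below
  it and Chebyshev's estimate above it.\<close>

lemma (in finite_measure)
  fixes Y :: "nat \<Rightarrow> 'a \<Rightarrow> real"
  assumes [measurable]: "\<And>n. Y n \<in> borel_measurable M"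
    and lim: "\<And>x. x \<in> space M \<Longrightarrow> (\<lambda>n. Y n x) \<longlonglongrightarrow> Z x"
    and int: "\<And>n. integrable M (\<lambda>x. (Y n x)\<^sup>2)"
    and bound: "\<And>n. (\<integral>x. (Y n x)\<^sup>2 \<partial>M) \<le> B"
  shows integrable_limit_bounded_L2: "integrable M Z"
    and integral_limit_bounded_L2: "(\<lambda>n. \<integral>x. Y n x \<partial>M) \<longlonglongrightarrow> (\<integral>x. Z x \<partial>M)"
proof -
  have [measurable]: "Z \<in> borel_measurable M"
    by (rule borel_measurable_LIMSEQ_real[OF lim]) auto
  have B0: "0 \<le> B" using bound[of 0] by (rule order_trans[rotated]) simp
  have "(\<integral>\<^sup>+x. ennreal ((Z x)\<^sup>2) \<partial>M) = (\<integral>\<^sup>+x. liminf (\<lambda>n. ennreal ((Y n x)\<^sup>2)) \<partial>M)"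
  proof (rule nn_integral_cong)
    fix x assume "x \<in> space M"
    then have "(\<lambda>n. ennreal ((Y n x)\<^sup>2)) \<longlonglongrightarrow> ennreal ((Z x)\<^sup>2)"
      by (intro tendsto_ennrealI tendsto_power lim)
    then show "ennreal ((Z x)\<^sup>2) = liminf (\<lambda>n. ennreal ((Y n x)\<^sup>2))"
      by (intro lim_imp_Liminf[symmetric]) auto
  qed
  also have "\<dots> \<le> liminf (\<lambda>n. \<integral>\<^sup>+x. ennreal ((Y n x)\<^sup>2) \<partial>M)"
    by (rule nn_integral_liminf) auto
  also have "\<dots> \<le> ennreal B"
  proof (rule Liminf_le)
    have "(\<integral>\<^sup>+x. ennreal ((Y n x)\<^sup>2) \<partial>M) \<le> ennreal B" for n
      using bound[of n] by (simp add: nn_integral_eq_integral[OF int] ennreal_leI)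
    then show "\<forall>\<^sub>F n in sequentially. (\<integral>\<^sup>+x. ennreal ((Y n x)\<^sup>2) \<partial>M) \<le> ennreal B" by simp
  qed simp
  finally have nnZ: "(\<integral>\<^sup>+x. ennreal ((Z x)\<^sup>2) \<partial>M) \<le> ennreal B" .
  then have Z2: "integrable M (\<lambda>x. (Z x)\<^sup>2)"
    by (intro integrableI_bounded) (auto simp: top_unique less_top[symmetric])
  have Z2_le: "(\<integral>x. (Z x)\<^sup>2 \<partial>M) \<le> B"
    using nnZ B0 by (simp add: nn_integral_eq_integral[OF Z2])
  show Z: "integrable M Z" by (rule square_integral_le) (auto intro: Z2)
  have Y: "integrable M (Y n)" for n by (rule square_integral_le) (auto intro: int)
  have diff_sq: "integrable M (\<lambda>x. (Y n x - Z x)\<^sup>2) \<and> (\<integral>x. (Y n x - Z x)\<^sup>2 \<partial>M) \<le> 4 * B" for n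
  proof
    have le: "(Y n x - Z x)\<^sup>2 \<le> 2 * (Y n x)\<^sup>2 + 2 * (Z x)\<^sup>2" for x
      using zero_le_power2[of "Y n x + Z x"] by (simp add: power2_eq_square algebra_simps)
    have i: "integrable M (\<lambda>x. 2 * (Y n x)\<^sup>2 + 2 * (Z x)\<^sup>2)" using int Z2 by simp
    show *: "integrable M (\<lambda>x. (Y n x - Z x)\<^sup>2)"
      by (rule Bochner_Integration.integrable_bound[OF i]) (use le in auto)
    have "(\<integral>x. (Y n x - Z x)\<^sup>2 \<partial>M) \<le> (\<integral>x. 2 * (Y n x)\<^sup>2 + 2 * (Z x)\<^sup>2 \<partial>M)"
      by (rule integral_mono[OF * i le])
    also have "\<dots> \<le> 4 * B" using int[of n] Z2 bound[of n] Z2_le by simp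
    finally show "(\<integral>x. (Y n x - Z x)\<^sup>2 \<partial>M) \<le> 4 * B" .
  qed
  have "(\<lambda>n. \<integral>x. \<bar>Y n x - Z x\<bar> \<partial>M) \<longlonglongrightarrow> 0"
  proof (rule LIMSEQ_I)
    fix e :: real assume "e > 0"
    \<comment> \<open>The part of the difference above \<open>K\<close> contributes at most
      \<open>4 * B / K\<close>, and this choice makes that at most \<open>e / 2\<close>. The summand
      1 keeps \<open>K\<close> positive when \<open>B\<close> is 0.\<close>
    define K where "K = 8 * (B + 1) / e"
    have K: "K > 0" using B0 \<open>e > 0\<close> by (simp add: K_def)
    have "(\<lambda>n. \<integral>x. min \<bar>Y n x - Z x\<bar> K \<partial>M) \<longlonglongrightarrow> (\<integral>x. 0 \<partial>M)"
    proof (rule integral_dominated_convergence[where w="\<lambda>_. K"])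
      show "AE x in M. (\<lambda>n. min \<bar>Y n x - Z x\<bar> K) \<longlonglongrightarrow> 0"
      proof (rule AE_I2)
        fix x assume "x \<in> space M"
        then have "(\<lambda>n. min \<bar>Y n x - Z x\<bar> K) \<longlonglongrightarrow> min \<bar>Z x - Z x\<bar> K"
          by (intro tendsto_intros lim)
        then show "(\<lambda>n. min \<bar>Y n x - Z x\<bar> K) \<longlonglongrightarrow> 0" using K by simp
      qed
    qed (use K in auto)
    then obtain N where N: "\<And>n. n \<ge> N \<Longrightarrow> \<bar>\<integral>x. min \<bar>Y n x - Z x\<bar> K \<partial>M\<bar> < e / 2"
      using LIMSEQ_D[of _ 0 "e/2"] \<open>e > 0\<close> by fastforce
    have "norm ((\<integral>x. \<bar>Y n x - Z x\<bar> \<partial>M) - 0) < e" if "n \<ge> N" for n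
    proof -
      have trunc: "\<bar>z\<bar> \<le> min \<bar>z\<bar> K + z\<^sup>2 / K" for z
      proof (cases "\<bar>z\<bar> \<le> K")
        case False
        then have "K * \<bar>z\<bar> \<le> \<bar>z\<bar> * \<bar>z\<bar>" by (intro mult_right_mono) auto
        then have "\<bar>z\<bar> \<le> z\<^sup>2 / K" using K by (simp add: field_simps power2_eq_square)
        then show ?thesis using K False by simp
      qed (use K in simp)
      have i1: "integrable M (\<lambda>x. min \<bar>Y n x - Z x\<bar> K)"
        using Y[of n] Z K by (intro Bochner_Integration.integrable_bound[OF integrable_const[of K]]) auto
      have "(\<integral>x. \<bar>Y n x - Z x\<bar> \<partial>M) \<le> (\<integral>x. min \<bar>Y n x - Z x\<bar> K + (Y n x - Z x)\<^sup>2 / K \<partial>M)"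
        by (rule integral_mono) (use i1 diff_sq Y Z trunc in auto)
      also have "\<dots> = (\<integral>x. min \<bar>Y n x - Z x\<bar> K \<partial>M) + (\<integral>x. (Y n x - Z x)\<^sup>2 \<partial>M) / K"
        using i1 diff_sq by simp
      also have "(\<integral>x. (Y n x - Z x)\<^sup>2 \<partial>M) / K \<le> 4 * B / K"
        using diff_sq[of n] K by (intro divide_right_mono) auto
      also have "4 * B / K \<le> e / 2"
        using B0 \<open>e > 0\<close> by (simp add: K_def field_simps)
      finally have "(\<integral>x. \<bar>Y n x - Z x\<bar> \<partial>M) < e" using N[OF that] by linarith
      moreover have "0 \<le> (\<integral>x. \<bar>Y n x - Z x\<bar> \<partial>M)" by simp
      ultimately show ?thesis by simp
    qed
    then show "\<exists>no. \<forall>n\<ge>no. norm ((\<integral>x. \<bar>Y n x - Z x\<bar> \<partial>M) - 0) < e" by blast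
  qed
  moreover have "norm ((\<integral>x. Y n x \<partial>M) - (\<integral>x. Z x \<partial>M)) \<le> (\<integral>x. \<bar>Y n x - Z x\<bar> \<partial>M)" for n
    using Y[of n] Z integral_norm_bound[of M "\<lambda>x. Y n x - Z x"] by simp
  ultimately have "(\<lambda>n. (\<integral>x. Y n x \<partial>M) - (\<integral>x. Z x \<partial>M)) \<longlonglongrightarrow> 0"
    by (rule Lim_null_comparison[OF eventuallyI, rotated])
  then show "(\<lambda>n. \<integral>x. Y n x \<partial>M) \<longlonglongrightarrow> (\<integral>x. Z x \<partial>M)" by (simp add: LIM_zero_iff)
qed

section \<open>Cadlag paths and their discretization\<close>

text \<open>One-sided limits bound the path on both sides of each point, and the value at the point
  is added by hand. Compactness then leaves finitely many neighbourhoods.\<close>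

lemma cadlag_bounded:
  assumes "\<alpha> \<in> cadlag T"
  obtains B where "B \<ge> 0" and "\<And>t. t \<in> {0..T} \<Longrightarrow> \<bar>\<alpha> t\<bar> \<le> B"
proof -
  have right: "\<exists>b>t. \<forall>s\<in>{0..T}. t < s \<and> s < b \<longrightarrow> \<bar>\<alpha> s\<bar> \<le> \<bar>\<alpha> t\<bar> + 1" if "t \<in> {0..T}" for t
  proof (cases "t < T")
    case True
    then have "(\<alpha> \<longlongrightarrow> \<alpha> t) (at_right t)" using assms that by (simp add: cadlag_def)
    then have "eventually (\<lambda>s. dist (\<alpha> s) (\<alpha> t) < 1) (at_right t)" by (rule tendstoD) simp
    then obtain b where "b > t" "\<And>s. t < s \<Longrightarrow> s < b \<Longrightarrow> dist (\<alpha> s) (\<alpha> t) < 1"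
      by (auto simp: eventually_at_right_field)
    then show ?thesis
      by (intro exI[of _ b] conjI, simp) (fastforce simp: dist_real_def)
  next
    case False
    then show ?thesis using that by (intro exI[of _ "t + 1"]) auto
  qed
  have left: "\<exists>b<t. \<exists>C. \<forall>s\<in>{0..T}. b < s \<and> s < t \<longrightarrow> \<bar>\<alpha> s\<bar> \<le> C" if "t \<in> {0..T}" for t
  proof (cases "0 < t")
    case True
    then have t: "t \<in> {0<..T}" using that by auto
    have "\<forall>t\<in>{0<..T}. \<exists>l. (\<alpha> \<longlongrightarrow> l) (at_left t)"
      using assms by (simp add: cadlag_def)
    from bspec[OF this t] obtain l where "(\<alpha> \<longlongrightarrow> l) (at_left t)" ..
    then have "eventually (\<lambda>s. dist (\<alpha> s) l < 1) (at_left t)" by (rule tendstoD) simp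
    then obtain b where "b < t" "\<And>s. b < s \<Longrightarrow> s < t \<Longrightarrow> dist (\<alpha> s) l < 1"
      by (auto simp: eventually_at_left_field)
    moreover from this have "\<forall>s\<in>{0..T}. b < s \<and> s < t \<longrightarrow> \<bar>\<alpha> s\<bar> \<le> \<bar>l\<bar> + 1"
      by (fastforce simp: dist_real_def)
    ultimately show ?thesis by blast
  next
    case False
    then show ?thesis using that by (intro exI[of _ "t - 1"]) auto
  qed
  have "\<exists>U C. open U \<and> t \<in> U \<and> (\<forall>s\<in>U \<inter> {0..T}. \<bar>\<alpha> s\<bar> \<le> C)" if t: "t \<in> {0..T}" for t
  proof -
    obtain b where b: "b > t" "\<forall>s\<in>{0..T}. t < s \<and> s < b \<longrightarrow> \<bar>\<alpha> s\<bar> \<le> \<bar>\<alpha> t\<bar> + 1"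
      using right[OF t] by auto
    obtain a C where a: "a < t" "\<forall>s\<in>{0..T}. a < s \<and> s < t \<longrightarrow> \<bar>\<alpha> s\<bar> \<le> C"
      using left[OF t] by auto
    have "\<bar>\<alpha> s\<bar> \<le> max (\<bar>\<alpha> t\<bar> + 1) C" if "s \<in> {a<..<b} \<inter> {0..T}" for s
      using that a(2) b(2) by (cases s t rule: linorder_cases) (auto simp: le_max_iff_disj)
    then show ?thesis
      using a(1) b(1) by (intro exI[of _ "{a<..<b}"] exI[of _ "max (\<bar>\<alpha> t\<bar> + 1) C"]) auto
  qed
  then obtain U C where U: "\<And>t. t \<in> {0..T} \<Longrightarrow> open (U t) \<and> t \<in> U t"
    and C: "\<And>t s. t \<in> {0..T} \<Longrightarrow> s \<in> U t \<inter> {0..T} \<Longrightarrow> \<bar>\<alpha> s\<bar> \<le> C t"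
    by metis
  have "compact {0..T}" by simp
  then obtain D where D: "D \<subseteq> {0..T}" "finite D" "{0..T} \<subseteq> (\<Union>t\<in>D. U t)"
    by (rule compactE_image[of _ "{0..T}" U]) (use U in auto)
  show ?thesis
  proof
    \<comment> \<open>A sum instead of a maximum, so that the empty \<open>D\<close> forced by
      \<open>T < 0\<close> is no special case.\<close>
    show "0 \<le> (\<Sum>t\<in>D. \<bar>C t\<bar>)" by (simp add: sum_nonneg)
    fix s assume s: "s \<in> {0..T}"
    then obtain t where t: "t \<in> D" "s \<in> U t" using D by auto
    then have "\<bar>\<alpha> s\<bar> \<le> \<bar>C t\<bar>" using C[of t s] s D(1) by force
    also have "\<dots> \<le> (\<Sum>t\<in>D. \<bar>C t\<bar>)" using t(1) D(2) by (intro member_le_sum) auto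
    finally show "\<bar>\<alpha> s\<bar> \<le> (\<Sum>t\<in>D. \<bar>C t\<bar>)" .
  qed
qed

lemma cadlag_affine:
  assumes "a \<in> cadlag T" "b \<in> cadlag T"
  shows "(\<lambda>s. a s + w * b s) \<in> cadlag T"
proof -
  have "\<exists>l. ((\<lambda>s. a s + w * b s) \<longlongrightarrow> l) (at_left t)" if t: "t \<in> {0<..T}" for t
  proof -
    obtain l where l: "(a \<longlongrightarrow> l) (at_left t)" using assms(1) t unfolding cadlag_def by blast
    obtain m where m: "(b \<longlongrightarrow> m) (at_left t)" using assms(2) t unfolding cadlag_def by blast
    show ?thesis using tendsto_add[OF l tendsto_mult_left[OF m]] by blast
  qed
  moreover have "((\<lambda>s. a s + w * b s) \<longlongrightarrow> a t + w * b t) (at_right t)" if "t \<in> {0..<T}" for t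
    using assms that by (intro tendsto_intros) (auto simp: cadlag_def)
  ultimately show ?thesis by (simp add: cadlag_def)
qed

text \<open>The point of the grid \<open>{1 / (n + 1), 2 / (n + 1), \<dots>}\<close> sampled at \<open>t\<close> lies strictly to the
  right of \<open>t\<close> if \<open>t < T\<close>: the sampled path is a cadlag step function, and it converges
  pointwise by right continuity, even at the fixed jump times of a process.\<close>

definition grid_index :: "nat \<Rightarrow> real \<Rightarrow> nat" where
  "grid_index n t = nat \<lfloor>real (Suc n) * t\<rfloor>"

definition grid_point :: "real \<Rightarrow> nat \<Rightarrow> nat \<Rightarrow> real" where
  "grid_point T n j = min T (real (Suc j) / real (Suc n))"

lemma grid_index_mono: "s \<le> t \<Longrightarrow> grid_index n s \<le> grid_index n t"
  unfolding grid_index_def by (intro nat_mono floor_mono mult_left_mono) auto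

lemma grid_point_mono: "i \<le> j \<Longrightarrow> grid_point T n i \<le> grid_point T n j"
  unfolding grid_point_def by (intro min.mono divide_right_mono) auto

lemma grid_point_in: "T > 0 \<Longrightarrow> grid_point T n j \<in> {0..T}"
  unfolding grid_point_def by auto

lemma
  assumes "t \<in> {0..T}"
  shows grid_point_index_le: "grid_point T n (grid_index n t) \<le> t + 1 / real (Suc n)"
    and grid_point_index_ge: "t \<le> grid_point T n (grid_index n t)"
    and grid_point_index_gr: "t < T \<Longrightarrow> t < grid_point T n (grid_index n t)"
proof -
  let ?c = "real (Suc n)"
  have "0 \<le> ?c * t" using assms by simp
  then have r: "real (Suc (grid_index n t)) = of_int \<lfloor>?c * t\<rfloor> + 1"
    unfolding grid_index_def by simp
  have "real (Suc (grid_index n t)) \<le> ?c * t + 1" unfolding r by linarith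
  then have "real (Suc (grid_index n t)) / ?c \<le> (?c * t + 1) / ?c"
    by (rule divide_right_mono) simp
  also have "\<dots> = t + 1 / ?c" by (simp add: field_simps)
  finally show "grid_point T n (grid_index n t) \<le> t + 1 / ?c"
    unfolding grid_point_def by linarith
  have "?c * t < real (Suc (grid_index n t))" unfolding r by linarith
  then have "t < real (Suc (grid_index n t)) / ?c" by (simp add: pos_less_divide_eq mult.commute)
  then show "t \<le> grid_point T n (grid_index n t)"
    and "t < T \<Longrightarrow> t < grid_point T n (grid_index n t)"
    unfolding grid_point_def using assms by auto
qed

lemma cadlag_grid_limit:
  assumes "\<alpha> \<in> cadlag T" and t: "t \<in> {0..T}"
  shows "(\<lambda>n. \<alpha> (grid_point T n (grid_index n t))) \<longlonglongrightarrow> \<alpha> t"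
proof (cases "t < T")
  case True
  then have "(\<alpha> \<longlongrightarrow> \<alpha> t) (at_right t)" using assms by (simp add: cadlag_def)
  moreover have "filterlim (\<lambda>n. grid_point T n (grid_index n t)) (at_right t) sequentially"
    unfolding filterlim_at
  proof
    show "\<forall>\<^sub>F n in sequentially. grid_point T n (grid_index n t) \<in> {t<..} \<and>
        grid_point T n (grid_index n t) \<noteq> t"
      using grid_point_index_gr[OF t True] by (intro always_eventually allI) (metis greaterThan_iff less_irrefl)
    have "(\<lambda>n. t + inverse (real (Suc n))) \<longlonglongrightarrow> t + 0"
      by (intro tendsto_intros LIMSEQ_inverse_real_of_nat)
    then show "(\<lambda>n. grid_point T n (grid_index n t)) \<longlonglongrightarrow> t"
      using grid_point_index_le[OF t] grid_point_index_ge[OF t]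
      by (rule_tac tendsto_sandwich[OF _ _ tendsto_const, of t _ _ "\<lambda>n. t + inverse (real (Suc n))"])
         (auto simp del: of_nat_Suc simp add: inverse_eq_divide)
  qed
  ultimately show ?thesis by (rule filterlim_compose)
next
  case False
  \<comment> \<open>There is no right limit to use at the end of the interval; the cap in
    \<open>grid_point\<close> makes the sample exact there.\<close>
  then have "grid_point T n (grid_index n t) = t" for n
    using t grid_point_index_ge[OF t, of n] by (auto simp: grid_point_def)
  then show ?thesis by simp
qed

lemma step_function_cadlag: "(\<lambda>t. y (grid_index n t)) \<in> cadlag T"
proof -
  let ?c = "real (Suc n)"
  have c: "?c > 0" by simp
  have "((\<lambda>t. y (grid_index n t)) \<longlongrightarrow> y (grid_index n t)) (at_right t)" for t
  proof (rule tendsto_eventually)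
    have "\<lfloor>?c * s\<rfloor> = \<lfloor>?c * t\<rfloor>" if "t < s" "s < (of_int \<lfloor>?c * t\<rfloor> + 1) / ?c" for s
    proof (rule floor_unique)
      have "?c * t \<le> ?c * s" using that c by (intro mult_left_mono) auto
      then show "of_int \<lfloor>?c * t\<rfloor> \<le> ?c * s" by linarith
      show "?c * s < of_int \<lfloor>?c * t\<rfloor> + 1"
        using that(2) c by (simp only: pos_less_divide_eq mult.commute)
    qed
    moreover have "t < (of_int \<lfloor>?c * t\<rfloor> + 1) / ?c"
      unfolding pos_less_divide_eq[OF c] mult.commute[of t] by linarith
    ultimately show "\<forall>\<^sub>F s in at_right t. y (grid_index n s) = y (grid_index n t)"
      unfolding eventually_at_right_field grid_index_def
      by (intro exI[of _ "(of_int \<lfloor>?c * t\<rfloor> + 1) / ?c"]) auto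
  qed
  \<comment> \<open>Just to the left of \<open>t\<close> the floor is
    \<open>\<lceil>?c * t\<rceil> - 1\<close>: the floor at \<open>t\<close> itself if
    \<open>t\<close> is interior to a cell, and one less if \<open>t\<close> is the left end of a
    cell.\<close>
  moreover have "((\<lambda>t. y (grid_index n t)) \<longlongrightarrow> y (nat (\<lceil>?c * t\<rceil> - 1))) (at_left t)" for t
  proof (rule tendsto_eventually)
    have "\<lfloor>?c * s\<rfloor> = \<lceil>?c * t\<rceil> - 1" if "s < t" "(of_int \<lceil>?c * t\<rceil> - 1) / ?c < s" for s
    proof (rule floor_unique)
      have "?c * s < ?c * t" using that c by (intro mult_strict_left_mono) auto
      then show "?c * s < of_int (\<lceil>?c * t\<rceil> - 1) + 1" by linarith
      have "of_int \<lceil>?c * t\<rceil> - 1 < s * ?c"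
        using that(2) c by (simp only: pos_divide_less_eq)
      then show "of_int (\<lceil>?c * t\<rceil> - 1) \<le> ?c * s" by (simp add: mult.commute)
    qed
    moreover have "(of_int \<lceil>?c * t\<rceil> - 1) / ?c < t"
      unfolding pos_divide_less_eq[OF c] mult.commute[of t] by linarith
    ultimately show "\<forall>\<^sub>F s in at_left t. y (grid_index n s) = y (nat (\<lceil>?c * t\<rceil> - 1))"
      unfolding eventually_at_left_field grid_index_def
      by (intro exI[of _ "(of_int \<lceil>?c * t\<rceil> - 1) / ?c"]) auto
  qed
  ultimately show ?thesis unfolding cadlag_def by blast
qed

lemma measurable_grid_index [measurable]: "grid_index n \<in> borel \<rightarrow>\<^sub>M count_space UNIV"
  unfolding grid_index_def by measurable

section \<open>Differentiation along families of paths\<close>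

locale interval_measure = finite_measure \<mu> for \<mu> :: "real measure" +
  fixes T p :: real
  assumes T_pos: "T > 0"
    and sets_\<mu>: "sets \<mu> = sets (restrict_space borel {0..T})"
    and p_ge: "p \<ge> 1"
begin

lemma space_\<mu>: "space \<mu> = {0..T}"
  using sets_eq_imp_space_eq[OF sets_\<mu>] by (simp add: space_restrict_space)

lemma measurable_grid_index_\<mu> [measurable]: "grid_index n \<in> \<mu> \<rightarrow>\<^sub>M count_space UNIV"
  using measurable_cong_sets[OF sets_\<mu> refl] measurable_restrict_space1[OF measurable_grid_index] by blast

text \<open>Each sample factors through \<open>grid_index\<close>, a measurable map into a discrete
  countable space, and the samples converge to the path.\<close>

lemma cadlag_measurable: "\<alpha> \<in> cadlag T \<Longrightarrow> \<alpha> \<in> borel_measurable \<mu>"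
  by (rule borel_measurable_LIMSEQ_real[OF cadlag_grid_limit]) (auto simp: space_\<mu>)

text \<open>The L^p norm of the constant 1, hence the factor that turns a uniform bound into an L^p
  bound.\<close>

definition mass :: real where "mass = measure \<mu> (space \<mu>) powr (1 / p)"

lemma mass_nonneg: "0 \<le> mass" by (simp add: mass_def)

lemma Lp_norm_nonneg: "0 \<le> Lp_norm \<mu> p h" by (simp add: Lp_norm_def)

lemma bounded_in_Lp:
  assumes [measurable]: "h \<in> borel_measurable \<mu>" and b: "\<And>s. s \<in> {0..T} \<Longrightarrow> \<bar>h s\<bar> \<le> b"
  shows "h \<in> Lp \<mu> p"
proof -
  have "integrable \<mu> (\<lambda>s. \<bar>h s\<bar> powr p)"
    by (rule Bochner_Integration.integrable_bound[OF integrable_const[of "b powr p"]])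
       (use b p_ge in \<open>auto simp: space_\<mu> intro!: powr_mono2\<close>)
  then show ?thesis by (simp add: Lp_def)
qed

lemma Lp_norm_mono:
  assumes [measurable]: "h \<in> borel_measurable \<mu>"
    and le: "\<And>s. s \<in> {0..T} \<Longrightarrow> \<bar>h s\<bar> \<le> g s" and g: "g \<in> Lp \<mu> p"
  shows "Lp_norm \<mu> p h \<le> Lp_norm \<mu> p g"
proof -
  have ig: "integrable \<mu> (\<lambda>s. \<bar>g s\<bar> powr p)" using g by (simp add: Lp_def)
  have le': "\<bar>h s\<bar> powr p \<le> \<bar>g s\<bar> powr p" if "s \<in> {0..T}" for s
    using le[OF that] p_ge by (intro powr_mono2) auto
  have "integrable \<mu> (\<lambda>s. \<bar>h s\<bar> powr p)"
    by (rule Bochner_Integration.integrable_bound[OF ig]) (use le' in \<open>auto simp: space_\<mu>\<close>)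
  then have "(\<integral>s. \<bar>h s\<bar> powr p \<partial>\<mu>) \<le> (\<integral>s. \<bar>g s\<bar> powr p \<partial>\<mu>)"
    using ig le' by (intro integral_mono) (auto simp: space_\<mu>)
  then show ?thesis
    unfolding Lp_norm_def using p_ge by (intro powr_mono2) auto
qed

lemma Lp_norm_le_bound:
  assumes "h \<in> borel_measurable \<mu>" "0 \<le> b" "\<And>s. s \<in> {0..T} \<Longrightarrow> \<bar>h s\<bar> \<le> b"
  shows "Lp_norm \<mu> p h \<le> b * mass"
proof -
  have "Lp_norm \<mu> p h \<le> Lp_norm \<mu> p (\<lambda>_. b)"
    by (rule Lp_norm_mono) (use assms in \<open>auto intro!: bounded_in_Lp\<close>)
  also have "\<dots> = b * mass"
    using assms(2) p_ge by (simp add: Lp_norm_def mass_def powr_mult powr_powr)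
  finally show ?thesis .
qed

lemma Lp_norm_cmult: "Lp_norm \<mu> p (\<lambda>s. c * h s) = \<bar>c\<bar> * Lp_norm \<mu> p h"
  using p_ge by (simp add: Lp_norm_def abs_mult powr_mult powr_powr)

lemma Lp_norm_tendsto_0:
  assumes meas: "\<And>n. h n \<in> borel_measurable \<mu>"
    and bound: "\<And>n t. t \<in> {0..T} \<Longrightarrow> \<bar>h n t\<bar> \<le> B"
    and lim: "\<And>t. t \<in> {0..T} \<Longrightarrow> (\<lambda>n. h n t) \<longlonglongrightarrow> 0"
  shows "(\<lambda>n. Lp_norm \<mu> p (h n)) \<longlonglongrightarrow> 0"
proof -
  have "(\<lambda>n. \<integral>t. \<bar>h n t\<bar> powr p \<partial>\<mu>) \<longlonglongrightarrow> (\<integral>t. 0 \<partial>\<mu>)"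
  proof (rule integral_dominated_convergence[where w = "\<lambda>_. B powr p"])
    show "(\<lambda>t. \<bar>h n t\<bar> powr p) \<in> borel_measurable \<mu>" for n using meas[of n] by measurable
    show "AE t in \<mu>. (\<lambda>n. \<bar>h n t\<bar> powr p) \<longlonglongrightarrow> 0"
      using lim p_ge by (intro AE_I2 tendsto_zero_powrI[where b = p] tendsto_rabs_zero) (auto simp: space_\<mu>)
    show "AE t in \<mu>. norm (\<bar>h n t\<bar> powr p) \<le> B powr p" for n
      using bound p_ge by (intro AE_I2) (auto simp: space_\<mu> intro!: powr_mono2)
  qed auto
  then show ?thesis
    unfolding Lp_norm_def using p_ge by (intro tendsto_zero_powrI[where b = "1 / p"]) auto
qed

lemma Lp_cmult: "h \<in> Lp \<mu> p \<Longrightarrow> (\<lambda>t. c * h t) \<in> Lp \<mu> p"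
  by (auto simp: Lp_def abs_mult powr_mult intro: borel_measurable_times)

text \<open>Trades the norm for an integral over time, which can be exchanged with the expectation.
  A number x >= 0 satisfies x^(1/p) <= 1 + x because p >= 1.\<close>

lemma Lp_norm_le: "Lp_norm \<mu> p h \<le> 1 + (\<integral>s. \<bar>h s\<bar> powr p \<partial>\<mu>)"
proof -
  let ?I = "\<integral>s. \<bar>h s\<bar> powr p \<partial>\<mu>"
  have "?I \<ge> 0" by simp
  then have "?I powr (1 / p) \<le> (1 + ?I) powr (1 / p)" using p_ge by (intro powr_mono2) auto
  also have "\<dots> \<le> (1 + ?I) powr 1" using p_ge \<open>?I \<ge> 0\<close> by (intro powr_mono) auto
  finally show ?thesis using \<open>?I \<ge> 0\<close> by (simp add: Lp_norm_def)
qed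

lemma Lp_norm_eq_0:
  assumes "h \<in> Lp \<mu> p" "Lp_norm \<mu> p h = 0"
  shows "AE s in \<mu>. h s = 0"
proof -
  have "(\<integral>s. \<bar>h s\<bar> powr p \<partial>\<mu>) = 0" using assms(2) by (simp add: Lp_norm_def)
  then have "AE s in \<mu>. \<bar>h s\<bar> powr p = 0"
    using assms(1) by (subst (asm) integral_nonneg_eq_0_iff_AE) (auto simp: Lp_def)
  then show ?thesis by eventually_elim simp
qed

text \<open>The measure is finite, so every conjugate space lies in L^1. That is enough to pair a
  gradient with a bounded path without Hoelder's inequality.\<close>

lemma Lp_conj_integrable:
  assumes "g \<in> Lp_conj \<mu> p"
  shows "integrable \<mu> g"
proof (cases "p = 1")
  case True
  then obtain C where [measurable]: "g \<in> borel_measurable \<mu>" and "AE s in \<mu>. \<bar>g s\<bar> \<le> C"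
    using assms by (auto simp: Lp_conj_def)
  then show ?thesis
    by (intro Bochner_Integration.integrable_bound[OF integrable_const[of C]]) (auto elim: eventually_mono)
next
  case False
  define q where "q = p / (p - 1)"
  have q: "q \<ge> 1" using False p_ge by (simp add: q_def field_simps)
  have [measurable]: "g \<in> borel_measurable \<mu>" and i: "integrable \<mu> (\<lambda>s. \<bar>g s\<bar> powr q)"
    using assms False by (auto simp: Lp_conj_def Lp_def q_def)
  have "\<bar>g s\<bar> \<le> 1 + \<bar>g s\<bar> powr q" for s
  proof (cases "\<bar>g s\<bar> \<le> 1")
    case True
    then show ?thesis using powr_ge_zero[of "\<bar>g s\<bar>" q] by linarith
  next
    case False
    then have "\<bar>g s\<bar> powr 1 \<le> \<bar>g s\<bar> powr q" using q by (intro powr_mono) auto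
    then show ?thesis using False by auto
  qed
  then show ?thesis
    by (intro Bochner_Integration.integrable_bound[OF Bochner_Integration.integrable_add[OF integrable_const[of 1] i]]) auto
qed

end

locale cadlag_functional = interval_measure +
  fixes F :: "(real \<Rightarrow> real) \<Rightarrow> real" and G :: "real \<Rightarrow> (real \<Rightarrow> real) \<Rightarrow> real" and C :: real
  assumes F_lipschitz': "\<And>\<alpha> \<beta>. \<alpha> \<in> cadlag T \<Longrightarrow> \<beta> \<in> cadlag T \<Longrightarrow>
           \<bar>F \<alpha> - F \<beta>\<bar> \<le> C * Lp_norm \<mu> p (\<lambda>s. \<alpha> s - \<beta> s)"
    and gradient_Lp: "\<And>\<alpha>. \<alpha> \<in> cadlag T \<Longrightarrow> (\<lambda>s. G s \<alpha>) \<in> Lp_conj \<mu> p"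
    and gradient: "\<And>\<alpha>. \<alpha> \<in> cadlag T \<Longrightarrow>
      ((\<lambda>h. \<bar>F (\<lambda>s. \<alpha> s + h s) - F \<alpha> - (\<integral>s. G s \<alpha> * h s \<partial>\<mu>)\<bar> / Lp_norm \<mu> p h)
        \<longlongrightarrow> 0) (Lp_to_zero \<mu> p)"
begin

text \<open>The sign of \<open>C\<close> is not given, although a negative \<open>C\<close> forces
  all these norms to vanish. With the absolute value the bound can be multiplied through
  inequalities.\<close>

lemma F_lipschitz:
  assumes "\<alpha> \<in> cadlag T" "\<beta> \<in> cadlag T"
  shows "\<bar>F \<alpha> - F \<beta>\<bar> \<le> \<bar>C\<bar> * Lp_norm \<mu> p (\<lambda>s. \<alpha> s - \<beta> s)"
  using F_lipschitz'[OF assms] mult_right_mono[OF abs_ge_self[of C] Lp_norm_nonneg] by (rule order_trans)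

lemma F_growth:
  assumes "\<alpha> \<in> cadlag T"
  shows "\<bar>F \<alpha>\<bar> \<le> \<bar>F (\<lambda>_. 0)\<bar> + \<bar>C\<bar> * Lp_norm \<mu> p \<alpha>"
proof -
  have "(\<lambda>_. 0) \<in> cadlag T" by (auto simp: cadlag_def)
  from F_lipschitz[OF assms this] show ?thesis by simp
qed

lemma integrable_gradient_mult:
  assumes \<alpha>: "\<alpha> \<in> cadlag T" and h: "h \<in> cadlag T"
  shows "integrable \<mu> (\<lambda>s. G s \<alpha> * h s)"
proof -
  have i: "integrable \<mu> (\<lambda>s. G s \<alpha>)" using gradient_Lp[OF \<alpha>] by (rule Lp_conj_integrable)
  obtain B where B: "B \<ge> 0" "\<And>t. t \<in> {0..T} \<Longrightarrow> \<bar>h t\<bar> \<le> B" using cadlag_bounded[OF h] by blast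
  show ?thesis
  proof (rule Bochner_Integration.integrable_bound)
    show "integrable \<mu> (\<lambda>s. B * \<bar>G s \<alpha>\<bar>)" using i by simp
    show "(\<lambda>s. G s \<alpha> * h s) \<in> borel_measurable \<mu>"
      using i cadlag_measurable[OF h] by (intro borel_measurable_times) auto
    show "AE s in \<mu>. norm (G s \<alpha> * h s) \<le> norm (B * \<bar>G s \<alpha>\<bar>)"
      using B by (intro AE_I2) (auto simp: space_\<mu> abs_mult mult.commute[of B] intro!: mult_left_mono)
  qed
qed

text \<open>Chain rule for a curve in path space. The curve is Lipschitz in the parameter, uniformly
  in time, so the L^p norm of its increment is of order \<open>\<bar>v - \<sigma>\<bar>\<close> and
  the Frechet remainder is negligible. The gradient term is linear in the curve and is
  differentiated under the integral.\<close>

lemma F_path_has_real_derivative: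
  assumes \<delta>: "\<delta> > 0"
    and a: "\<And>v. \<bar>v - \<sigma>\<bar> < \<delta> \<Longrightarrow> a v \<in> cadlag T"
    and B0: "B \<ge> 0"
    and B: "\<And>v s. \<bar>v - \<sigma>\<bar> < \<delta> \<Longrightarrow> s \<in> {0..T} \<Longrightarrow> \<bar>a v s - a \<sigma> s\<bar> \<le> \<bar>v - \<sigma>\<bar> * B"
    and deriv: "\<And>s. s \<in> {0..T} \<Longrightarrow> ((\<lambda>v. a v s) has_real_derivative a' s) (at \<sigma>)"
  shows "((\<lambda>v. F (a v)) has_real_derivative (\<integral>s. G s (a \<sigma>) * a' s \<partial>\<mu>)) (at \<sigma>)"
proof -
  have a\<sigma>: "a \<sigma> \<in> cadlag T" using a[of \<sigma>] \<delta> by simp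
  have iG: "integrable \<mu> (\<lambda>s. G s (a \<sigma>))" using gradient_Lp[OF a\<sigma>] by (rule Lp_conj_integrable)
  let ?I = "\<lambda>v. \<integral>s. G s (a \<sigma>) * a v s \<partial>\<mu>"
  have linear: "(?I has_real_derivative (\<integral>s. G s (a \<sigma>) * a' s \<partial>\<mu>)) (at \<sigma>)"
  proof (rule has_real_derivative_integral[OF \<delta>])
    fix v assume v: "\<bar>v - \<sigma>\<bar> < \<delta>"
    show "integrable \<mu> (\<lambda>s. G s (a \<sigma>) * a v s)" by (rule integrable_gradient_mult[OF a\<sigma> a[OF v]])
    fix s assume "s \<in> space \<mu>"
    then have "\<bar>G s (a \<sigma>)\<bar> * \<bar>a v s - a \<sigma> s\<bar> \<le> \<bar>G s (a \<sigma>)\<bar> * (\<bar>v - \<sigma>\<bar> * B)"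
      using B[OF v] by (intro mult_left_mono) (auto simp: space_\<mu>)
    then show "\<bar>G s (a \<sigma>) * a v s - G s (a \<sigma>) * a \<sigma> s\<bar> \<le> \<bar>v - \<sigma>\<bar> * (\<bar>G s (a \<sigma>)\<bar> * B)"
      by (simp only: right_diff_distrib[symmetric] abs_mult mult.left_commute)
  next
    fix s assume "s \<in> space \<mu>"
    then show "((\<lambda>v. G s (a \<sigma>) * a v s) has_real_derivative G s (a \<sigma>) * a' s) (at \<sigma>)"
      using deriv by (intro DERIV_cmult) (auto simp: space_\<mu>)
  qed (use iG in auto)
  \<comment> \<open>The Frechet remainder along the curve: \<open>F (a v)\<close> is
    \<open>R v\<close> plus the linear term \<open>?I v\<close> plus a constant.\<close>
  define R where "R v = F (a v) - F (a \<sigma>) - (?I v - ?I \<sigma>)" for v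
  have "(R has_real_derivative 0) (at \<sigma>)"
    unfolding has_field_derivative_iff
  proof (rule LIM_I)
    fix e :: real assume e: "e > 0"
    \<comment> \<open>A Lipschitz constant of the curve in L^p, made positive by the summand 1. The
      remainder is measured with \<open>e / (2 * K)\<close> below, because the limit asks for a
      strict inequality and the bound on \<open>R\<close> is a weak one.\<close>
    define K where "K = B * mass + 1"
    have K: "K > 0" using B0 mass_nonneg by (simp add: K_def add_nonneg_pos)
    have "\<forall>\<^sub>F h in Lp_to_zero \<mu> p. dist (\<bar>F (\<lambda>s. a \<sigma> s + h s) - F (a \<sigma>) - (\<integral>s. G s (a \<sigma>) * h s \<partial>\<mu>)\<bar> / Lp_norm \<mu> p h) 0 < e / (2 * K)"
      by (rule tendstoD[OF gradient[OF a\<sigma>]]) (use e K in simp)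
    then obtain Q where Q: "eventually Q (at_right 0)"
      "\<And>h. Q (Lp_norm \<mu> p h) \<Longrightarrow> h \<in> Lp \<mu> p \<Longrightarrow>
        dist (\<bar>F (\<lambda>s. a \<sigma> s + h s) - F (a \<sigma>) - (\<integral>s. G s (a \<sigma>) * h s \<partial>\<mu>)\<bar> / Lp_norm \<mu> p h) 0 < e / (2 * K)"
      unfolding Lp_to_zero_def eventually_inf_principal eventually_filtercomap by blast
    from Q(1) obtain \<eta> where \<eta>: "\<eta> > 0" "\<And>y. 0 < y \<Longrightarrow> y < \<eta> \<Longrightarrow> Q y"
      by (auto simp: eventually_at_right_field)
    have R_le: "\<bar>R v\<bar> \<le> e / 2 * \<bar>v - \<sigma>\<bar>" if v: "\<bar>v - \<sigma>\<bar> < \<delta>" "\<bar>v - \<sigma>\<bar> < \<eta> / K" for v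
    proof -
      define h where "h s = a v s - a \<sigma> s" for s
      have [measurable]: "h \<in> borel_measurable \<mu>"
        unfolding h_def using cadlag_measurable[OF a[OF v(1)]] cadlag_measurable[OF a\<sigma>] by simp
      have hL: "h \<in> Lp \<mu> p" by (rule bounded_in_Lp) (use B[OF v(1)] in \<open>auto simp: h_def\<close>)
      have "Lp_norm \<mu> p h \<le> (\<bar>v - \<sigma>\<bar> * B) * mass"
        by (rule Lp_norm_le_bound) (use B[OF v(1)] B0 in \<open>auto simp: h_def\<close>)
      also have "\<dots> \<le> \<bar>v - \<sigma>\<bar> * K" by (simp add: K_def algebra_simps)
      finally have N: "Lp_norm \<mu> p h \<le> \<bar>v - \<sigma>\<bar> * K" .
      have "\<bar>v - \<sigma>\<bar> * K < \<eta>" using v(2) K by (simp add: pos_less_divide_eq)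
      have Fh: "F (\<lambda>s. a \<sigma> s + h s) = F (a v)" by (simp add: h_def)
      have Ih: "(\<integral>s. G s (a \<sigma>) * h s \<partial>\<mu>) = ?I v - ?I \<sigma>"
        unfolding h_def right_diff_distrib
        by (rule Bochner_Integration.integral_diff) (auto intro!: integrable_gradient_mult a\<sigma> a v)
      show ?thesis
      proof (cases "Lp_norm \<mu> p h = 0")
        case True
        \<comment> \<open>The filter \<open>Lp_to_zero\<close> leaves out increments of norm 0 and
          so says nothing about them; here the Lipschitz bound shows that \<open>F\<close> does not
          change.\<close>
        have "AE s in \<mu>. h s = 0" by (rule Lp_norm_eq_0[OF hL True])
        then have "(\<integral>s. G s (a \<sigma>) * h s \<partial>\<mu>) = 0"
          by (intro integral_eq_zero_AE) (auto elim: eventually_mono)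
        moreover have "F (a v) = F (a \<sigma>)"
          using F_lipschitz[OF a[OF v(1)] a\<sigma>] True by (simp add: h_def[abs_def])
        ultimately show ?thesis using e by (simp add: R_def Ih)
      next
        case False
        then have pos: "Lp_norm \<mu> p h > 0" using Lp_norm_nonneg[of h] by linarith
        have "Q (Lp_norm \<mu> p h)" using pos N \<open>\<bar>v - \<sigma>\<bar> * K < \<eta>\<close> by (intro \<eta>(2)) auto
        from Q(2)[OF this hL] have "\<bar>R v\<bar> / Lp_norm \<mu> p h < e / (2 * K)"
          by (simp add: Fh Ih R_def dist_real_def abs_divide Lp_norm_nonneg)
        then have "\<bar>R v\<bar> < e / (2 * K) * Lp_norm \<mu> p h" using pos by (simp add: pos_divide_less_eq)
        also have "\<dots> \<le> e / (2 * K) * (\<bar>v - \<sigma>\<bar> * K)" using N e K by (intro mult_left_mono) auto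
        also have "\<dots> = e / 2 * \<bar>v - \<sigma>\<bar>" using K by simp
        finally show ?thesis by simp
      qed
    qed
    have R\<sigma>: "R \<sigma> = 0" by (simp add: R_def)
    show "\<exists>s>0. \<forall>x. x \<noteq> \<sigma> \<and> norm (x - \<sigma>) < s \<longrightarrow> norm ((R x - R \<sigma>) / (x - \<sigma>) - 0) < e"
    proof (intro exI conjI allI impI)
      show "0 < min \<delta> (\<eta> / K)" using \<delta> \<eta> K by simp
      fix x assume x: "x \<noteq> \<sigma> \<and> norm (x - \<sigma>) < min \<delta> (\<eta> / K)"
      have "\<bar>R x\<bar> \<le> e / 2 * \<bar>x - \<sigma>\<bar>" using x by (intro R_le) auto
      also have "\<dots> < e * \<bar>x - \<sigma>\<bar>" using x e by simp
      finally show "norm ((R x - R \<sigma>) / (x - \<sigma>) - 0) < e"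
        using x by (simp add: R\<sigma> abs_divide pos_divide_less_eq)
    qed
  qed
  from DERIV_add[OF DERIV_add[OF this linear] DERIV_const[of "F (a \<sigma>) - ?I \<sigma>"]]
  show ?thesis by (simp add: R_def)
qed

end

section \<open>Convex order for independent exponential factors\<close>

locale independent_exponentials = prob_space M for M :: "'w measure" +
  fixes D :: "nat \<Rightarrow> 'w \<Rightarrow> real"
  assumes indep: "indep_vars (\<lambda>_. borel) D UNIV"
    and exp_integrable: "\<And>i u. integrable M (\<lambda>\<omega>. exp (u * D i \<omega>))"
begin

definition W :: "nat \<Rightarrow> real \<Rightarrow> real \<Rightarrow> real" where
  "W i u x = exp (u * x) / (\<integral>\<omega>. exp (u * D i \<omega>) \<partial>M)"

text \<open>Every factor has a parameter of its own, so that the parameters can be raised one at a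
  time; a constant \<open>s\<close> gives the normalized exponential sampled on a grid.\<close>

definition Y :: "(nat \<Rightarrow> real) \<Rightarrow> nat \<Rightarrow> (nat \<Rightarrow> real) \<Rightarrow> real" where
  "Y s i x = (\<Prod>k\<le>i. W k (s k) (x k))"

lemma D_measurable [measurable]: "D i \<in> borel_measurable M"
  using indep by (auto simp: indep_vars_def)

lemma W_measurable [measurable]: "W i u \<in> borel_measurable borel"
  unfolding W_def[abs_def] by measurable

lemma exp_moment_pos: "(\<integral>\<omega>. exp (u * D i \<omega>) \<partial>M) > 0"
proof -
  have "0 \<le> (\<integral>\<omega>. exp (u * D i \<omega>) \<partial>M)" by simp
  moreover have "(\<integral>\<omega>. exp (u * D i \<omega>) \<partial>M) \<noteq> 0"
    using exp_integrable[of u i] by (subst integral_nonneg_eq_0_iff_AE) (auto simp: AE_False)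
  ultimately show ?thesis by linarith
qed

lemma W_pos: "W i u x > 0"
  using exp_moment_pos by (simp add: W_def)

lemma W_integrable: "integrable M (\<lambda>\<omega>. W i u (D i \<omega>))"
  unfolding W_def by (intro integrable_divide exp_integrable)

lemma W_integral: "(\<integral>\<omega>. W i u (D i \<omega>) \<partial>M) = 1"
  unfolding W_def using exp_moment_pos[of u i] by simp

lemma W_prod_integrable:
  assumes "finite J"
  shows "integrable M (\<lambda>\<omega>. \<Prod>k\<in>J. W k (s k) (D k \<omega>))"
  using assms
proof (rule indep_vars_integrable)
  show "indep_vars (\<lambda>_. borel) (\<lambda>k \<omega>. W k (s k) (D k \<omega>)) J"
    by (rule indep_vars_compose2[OF indep_vars_subset[OF indep]]) auto
qed (rule W_integrable)

text \<open>The increasing functions \<open>W j u\<close> and \<open>W j r\<close> cross exactly once, so that passing to the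
  larger parameter moves every value away from the common value \<open>w\<close> at the crossing.\<close>

lemma W_crossing:
  assumes "0 \<le> u" "u < r"
  shows "\<exists>w. \<forall>x. w \<le> W j u x \<and> W j u x \<le> W j r x \<or> W j r x \<le> W j u x \<and> W j u x \<le> w"
proof -
  define m where "m v = (\<integral>\<omega>. exp (v * D j \<omega>) \<partial>M)" for v
  have m: "m v > 0" for v unfolding m_def by (rule exp_moment_pos)
  have W: "W j v x = exp (v * x - ln (m v))" for v x
    using m[of v] by (simp add: W_def m_def exp_diff)
  \<comment> \<open>The argument at which the exponents \<open>u * x - ln (m u)\<close> and
    \<open>r * x - ln (m r)\<close> agree. As \<open>u\<close> is nonnegative, \<open>W j u\<close>
    is non-decreasing, so the side of \<open>d\<close> on which \<open>x\<close> lies decides the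
    side of the crossing value.\<close>
  define d where "d = (ln (m r) - ln (m u)) / (r - u)"
  have d: "(r - u) * d = ln (m r) - ln (m u)" using assms by (simp add: d_def)
  show ?thesis
  proof (intro exI allI)
    fix x
    show "W j u d \<le> W j u x \<and> W j u x \<le> W j r x \<or> W j r x \<le> W j u x \<and> W j u x \<le> W j u d"
    proof (cases "d \<le> x")
      case True
      then have "u * d \<le> u * x" "(r - u) * d \<le> (r - u) * x"
        using assms by (auto intro: mult_left_mono)
      then show ?thesis unfolding W exp_le_cancel_iff using d by (simp add: algebra_simps)
    next
      case False
      then have "u * x \<le> u * d" "(r - u) * x \<le> (r - u) * d"
        using assms by (auto intro: mult_left_mono)
      then show ?thesis unfolding W exp_le_cancel_iff using d by (simp add: algebra_simps)
    qed
  qed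
qed

end

section \<open>Functions of finitely many coordinates, convex along nonnegative directions\<close>

locale coordinate_lipschitz =
  fixes \<Phi> :: "(nat \<Rightarrow> real) \<Rightarrow> real" and K :: real and N :: nat
  assumes K_nonneg: "K \<ge> 0"
    and lipschitz: "\<And>y z. \<bar>\<Phi> y - \<Phi> z\<bar> \<le> K * (\<Sum>i\<le>N. \<bar>y i - z i\<bar>)"
begin

lemma \<Phi>_cong: "(\<And>i. i \<le> N \<Longrightarrow> y i = z i) \<Longrightarrow> \<Phi> y = \<Phi> z"
  using lipschitz[of y z] by simp

text \<open>A Lipschitz bound in finitely many coordinates makes \<Phi> continuous for the product
  topology, hence Borel on the space of sequences.\<close>

lemma \<Phi>_measurable:
  assumes "\<And>i. (\<lambda>x. y x i) \<in> borel_measurable M"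
  shows "(\<lambda>x. \<Phi> (y x)) \<in> borel_measurable M"
proof -
  have "continuous_on UNIV \<Phi>"
    unfolding continuous_on_def
  proof
    fix y :: "nat \<Rightarrow> real"
    have "((\<lambda>z. z i) \<longlongrightarrow> y i) (at y)" for i
      using continuous_on_product_coordinates[of i] unfolding continuous_on_def by blast
    then have "((\<lambda>z. K * (\<Sum>i\<le>N. \<bar>z i - y i\<bar>)) \<longlongrightarrow> K * (\<Sum>i\<le>N. \<bar>y i - y i\<bar>)) (at y)"
      by (intro tendsto_intros)
    then have "((\<lambda>z. \<Phi> z - \<Phi> y) \<longlongrightarrow> 0) (at y)"
      by (rule_tac Lim_null_comparison[OF always_eventually, of _ "\<lambda>z. K * (\<Sum>i\<le>N. \<bar>z i - y i\<bar>)"])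
         (use lipschitz in auto)
    then show "(\<Phi> \<longlongrightarrow> \<Phi> y) (at y within UNIV)" by (simp add: LIM_zero_iff)
  qed
  then have "\<Phi> \<in> borel_measurable borel" by (rule borel_measurable_continuous_onI)
  moreover have "y \<in> borel_measurable M"
    by (rule measurable_coordinatewise_then_product) (rule assms)
  ultimately show ?thesis by (rule measurable_compose[rotated])
qed

end

text \<open>Convexity is recorded as monotonicity of the derivative along a line, because the slope
  at one prescribed point is what the argument uses.\<close>

locale directionally_convex = coordinate_lipschitz +
  fixes \<Phi>' :: "(nat \<Rightarrow> real) \<Rightarrow> (nat \<Rightarrow> real) \<Rightarrow> real \<Rightarrow> real"
  assumes deriv: "\<And>y b w. (\<And>i. b i \<ge> 0) \<Longrightarrow>
      ((\<lambda>w. \<Phi> (\<lambda>i. y i + w * b i)) has_real_derivative \<Phi>' y b w) (at w)"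
    and deriv_mono: "\<And>y b w w'. (\<And>i. b i \<ge> 0) \<Longrightarrow> w \<le> w' \<Longrightarrow> \<Phi>' y b w \<le> \<Phi>' y b w'"
begin

text \<open>Expresses the slope through values of \<Phi> along a sequence. Both its bound and its
  measurability in the base point and the direction are read off from this, since the locale assumes
  neither.\<close>

lemma \<Phi>'_limit:
  assumes "\<And>i. b i \<ge> 0"
  shows "(\<lambda>n. (\<Phi> (\<lambda>i. y i + (w + inverse (real (Suc n))) * b i) - \<Phi> (\<lambda>i. y i + w * b i)) * real (Suc n))
    \<longlonglongrightarrow> \<Phi>' y b w"
proof -
  have "((\<lambda>v. (\<Phi> (\<lambda>i. y i + v * b i) - \<Phi> (\<lambda>i. y i + w * b i)) / (v - w)) \<longlongrightarrow> \<Phi>' y b w) (at w)"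
    using deriv[of b y w] assms by (simp add: has_field_derivative_iff)
  moreover have "(\<lambda>n. w + inverse (real (Suc n))) \<longlonglongrightarrow> w + 0"
    by (intro tendsto_intros LIMSEQ_inverse_real_of_nat)
  then have "filterlim (\<lambda>n. w + inverse (real (Suc n))) (at w) sequentially"
    by (simp add: filterlim_at del: of_nat_Suc)
  ultimately have "(\<lambda>n. (\<Phi> (\<lambda>i. y i + (w + inverse (real (Suc n))) * b i) - \<Phi> (\<lambda>i. y i + w * b i))
      / (w + inverse (real (Suc n)) - w)) \<longlonglongrightarrow> \<Phi>' y b w"
    by (rule filterlim_compose)
  then show ?thesis by (simp add: divide_inverse del: of_nat_Suc)
qed

lemma \<Phi>'_bound:
  assumes "\<And>i. b i \<ge> 0"
  shows "\<bar>\<Phi>' y b w\<bar> \<le> K * (\<Sum>i\<le>N. b i)"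
proof (rule LIMSEQ_le_const2[OF tendsto_rabs[OF \<Phi>'_limit[OF assms]]])
  have "\<bar>(\<Phi> (\<lambda>i. y i + (w + inverse (real (Suc n))) * b i) - \<Phi> (\<lambda>i. y i + w * b i)) * real (Suc n)\<bar>
      \<le> K * (\<Sum>i\<le>N. b i)" for n
  proof -
    let ?e = "inverse (real (Suc n))"
    have "\<bar>\<Phi> (\<lambda>i. y i + (w + ?e) * b i) - \<Phi> (\<lambda>i. y i + w * b i)\<bar>
        \<le> K * (\<Sum>i\<le>N. \<bar>(y i + (w + ?e) * b i) - (y i + w * b i)\<bar>)"
      by (rule lipschitz)
    also have "(\<Sum>i\<le>N. \<bar>(y i + (w + ?e) * b i) - (y i + w * b i)\<bar>) = (\<Sum>i\<le>N. ?e * b i)"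
      using assms by (intro sum.cong) (auto simp: algebra_simps abs_mult)
    also have "\<dots> = ?e * (\<Sum>i\<le>N. b i)" by (simp add: sum_distrib_left)
    finally have "\<bar>\<Phi> (\<lambda>i. y i + (w + ?e) * b i) - \<Phi> (\<lambda>i. y i + w * b i)\<bar> * real (Suc n)
        \<le> (K * (?e * (\<Sum>i\<le>N. b i))) * real (Suc n)"
      by (rule mult_right_mono) simp
    also have "\<dots> = K * (\<Sum>i\<le>N. b i)" by (simp add: field_simps del: of_nat_Suc)
    finally show ?thesis by (simp add: abs_mult)
  qed
  then show "\<exists>M. \<forall>n\<ge>M. \<bar>(\<Phi> (\<lambda>i. y i + (w + inverse (real (Suc n))) * b i) - \<Phi> (\<lambda>i. y i + w * b i)) * real (Suc n)\<bar>
      \<le> K * (\<Sum>i\<le>N. b i)" by blast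
qed

text \<open>The slope is taken at \<open>w\<close> and not at the starting point \<open>v\<close>.
  As \<open>v\<close> lies between \<open>w\<close> and \<open>v'\<close>, the mean value slope is
  attained on the far side of \<open>v\<close> seen from \<open>w\<close>, and monotonicity of the
  derivative has the right sign in both orders. With \<open>w\<close> fixed in advance the slope
  does not involve the factor that moves.\<close>

lemma \<Phi>_tangent:
  assumes b: "\<And>i. b i \<ge> 0" and order: "w \<le> v \<and> v \<le> v' \<or> v' \<le> v \<and> v \<le> w"
  shows "\<Phi>' y b w * (v' - v) \<le> \<Phi> (\<lambda>i. y i + v' * b i) - \<Phi> (\<lambda>i. y i + v * b i)"
proof (cases v v' rule: linorder_cases)
  case less
  then obtain z where z: "v < z" "z < v'"
    "\<Phi> (\<lambda>i. y i + v' * b i) - \<Phi> (\<lambda>i. y i + v * b i) = (v' - v) * \<Phi>' y b z"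
    using MVT2[of v v' "\<lambda>w. \<Phi> (\<lambda>i. y i + w * b i)" "\<Phi>' y b"] deriv[of b y] b by blast
  have "\<Phi>' y b w \<le> \<Phi>' y b z" using b order less z by (intro deriv_mono) auto
  then have "\<Phi>' y b w * (v' - v) \<le> \<Phi>' y b z * (v' - v)" using less by (intro mult_right_mono) auto
  then show ?thesis using z by (simp add: mult.commute)
next
  case greater
  then obtain z where z: "v' < z" "z < v"
    "\<Phi> (\<lambda>i. y i + v * b i) - \<Phi> (\<lambda>i. y i + v' * b i) = (v - v') * \<Phi>' y b z"
    using MVT2[of v' v "\<lambda>w. \<Phi> (\<lambda>i. y i + w * b i)" "\<Phi>' y b"] deriv[of b y] b by blast
  have "\<Phi>' y b z \<le> \<Phi>' y b w" using b order greater z by (intro deriv_mono) auto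
  then have "\<Phi>' y b z * (v - v') \<le> \<Phi>' y b w * (v - v')" using greater by (intro mult_right_mono) auto
  moreover have "\<Phi>' y b w * (v' - v) = - (\<Phi>' y b w * (v - v'))" by (simp add: algebra_simps)
  ultimately show ?thesis using z(3) by (simp add: mult.commute)
qed simp

end

section \<open>Raising the parameters of the factors one at a time\<close>

locale convex_in_exponentials = independent_exponentials + directionally_convex
begin

lemma \<Phi>_Y_integrable: "integrable M (\<lambda>\<omega>. \<Phi> (\<lambda>i. Y s i (\<lambda>k. D k \<omega>)))"
proof (rule Bochner_Integration.integrable_bound)
  have Yi: "integrable M (\<lambda>\<omega>. Y s i (\<lambda>k. D k \<omega>))" for i
    unfolding Y_def by (rule W_prod_integrable) simp
  then show "integrable M (\<lambda>\<omega>. \<bar>\<Phi> (\<lambda>_. 0)\<bar> + K * (\<Sum>i\<le>N. \<bar>Y s i (\<lambda>k. D k \<omega>)\<bar>))"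
    by (intro Bochner_Integration.integrable_add integrable_const integrable_mult_right
      Bochner_Integration.integrable_sum integrable_abs)
  show "(\<lambda>\<omega>. \<Phi> (\<lambda>i. Y s i (\<lambda>k. D k \<omega>))) \<in> borel_measurable M"
    using Yi by (intro \<Phi>_measurable) auto
  have "\<bar>\<Phi> y\<bar> \<le> \<bar>\<Phi> (\<lambda>_. 0)\<bar> + K * (\<Sum>i\<le>N. \<bar>y i\<bar>)" for y
    using lipschitz[of y "\<lambda>_. 0"] by simp
  then show "AE \<omega> in M. norm (\<Phi> (\<lambda>i. Y s i (\<lambda>k. D k \<omega>)))
      \<le> norm (\<bar>\<Phi> (\<lambda>_. 0)\<bar> + K * (\<Sum>i\<le>N. \<bar>Y s i (\<lambda>k. D k \<omega>)\<bar>))"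
    by (intro AE_I2) (fastforce intro: order_trans[OF _ abs_ge_self])
qed

text \<open>As a function of the single factor with index \<open>j\<close>, the integrand is convex. Its slope
  at the crossing point depends only on the other variables, hence is independent of the
  centred difference of the two factors.\<close>

lemma expectation_mono_one_parameter:
  assumes s: "0 \<le> s j" "s j < r"
  shows "(\<integral>\<omega>. \<Phi> (\<lambda>i. Y s i (\<lambda>k. D k \<omega>)) \<partial>M) \<le> (\<integral>\<omega>. \<Phi> (\<lambda>i. Y (s(j := r)) i (\<lambda>k. D k \<omega>)) \<partial>M)"
proof -
  obtain w where w: "\<forall>x. w \<le> W j (s j) x \<and> W j (s j) x \<le> W j r x
      \<or> W j r x \<le> W j (s j) x \<and> W j (s j) x \<le> w"
    using W_crossing[OF s] by blast
  \<comment> \<open>The product \<open>Y s i\<close> without its factor of index \<open>j\<close>.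
    The coordinates below \<open>j\<close> lack that factor and form the base point
    \<open>a\<close>; the others form the direction \<open>b\<close>.\<close>
  define V where "V i x = (\<Prod>k\<in>{..i} - {j}. W k (s k) (x k))" for i and x :: "nat \<Rightarrow> real"
  define a where "a x i = (if i < j then V i x else 0)" for i and x :: "nat \<Rightarrow> real"
  define b where "b x i = (if i < j then 0 else V i x)" for i and x :: "nat \<Rightarrow> real"
  have V_pos: "V i x > 0" for i x unfolding V_def by (intro prod_pos W_pos)
  then have b: "b x i \<ge> 0" for i x by (simp add: b_def less_imp_le)
  \<comment> \<open>The same \<open>a\<close> and \<open>b\<close> serve \<open>s\<close> and
    \<open>s(j := r)\<close>, because \<open>V\<close> does not involve the parameter
    \<open>s j\<close>.\<close>
  have Y_eq: "Y s' i x = a x i + W j (s' j) (x j) * b x i" if "\<And>k. k \<noteq> j \<Longrightarrow> s' k = s k" for s' i x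
  proof -
    have V_eq: "V i x = (\<Prod>k\<in>{..i} - {j}. W k (s' k) (x k))"
      unfolding V_def using that by (intro prod.cong) auto
    show ?thesis
    proof (cases "i < j")
      case True
      then have "{..i} - {j} = {..i}" by auto
      then show ?thesis using True by (simp add: Y_def a_def b_def V_eq)
    next
      case False
      then have "(\<Prod>k\<le>i. W k (s' k) (x k)) = W j (s' j) (x j) * (\<Prod>k\<in>{..i} - {j}. W k (s' k) (x k))"
        by (intro prod.remove) auto
      then show ?thesis using False by (simp add: Y_def a_def b_def V_eq)
    qed
  qed
  define S where "S x = \<Phi>' (a x) (b x) w" for x
  define E where "E x = W j r (x j) - W j (s j) (x j)" for x :: "nat \<Rightarrow> real"
  have tangent: "S x * E x \<le> \<Phi> (\<lambda>i. Y (s(j := r)) i x) - \<Phi> (\<lambda>i. Y s i x)" for x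
    using \<Phi>_tangent[OF b[of x] w[rule_format, of "x j"], of "a x"] by (simp add: S_def E_def Y_eq)
  let ?D = "\<lambda>\<omega> k. D k \<omega>"
  let ?J = "UNIV - {j}"
  let ?R = "\<lambda>A \<omega>. restrict (\<lambda>k. D k \<omega>) A"
  have V_meas [measurable]: "V i \<in> borel_measurable (PiM ?J (\<lambda>_. borel))" for i
    unfolding V_def by (intro borel_measurable_prod measurable_compose[OF measurable_component_singleton]) auto
  have [measurable]: "(\<lambda>x. a x i) \<in> borel_measurable (PiM ?J (\<lambda>_. borel))"
    "(\<lambda>x. b x i) \<in> borel_measurable (PiM ?J (\<lambda>_. borel))" for i
    unfolding a_def b_def by measurable
  have S_meas [measurable]: "S \<in> borel_measurable (PiM ?J (\<lambda>_. borel))"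
    unfolding S_def[abs_def]
    by (rule borel_measurable_LIMSEQ_real[OF \<Phi>'_limit[OF b]])
       (intro borel_measurable_times borel_measurable_diff \<Phi>_measurable; measurable)
  have E_meas [measurable]: "E \<in> borel_measurable (PiM {j} (\<lambda>_. borel))"
    unfolding E_def by (intro borel_measurable_diff measurable_compose[OF measurable_component_singleton]) auto
  \<comment> \<open>\<open>S\<close> reads only the coordinates other than \<open>j\<close> and
    \<open>E\<close> only the coordinate \<open>j\<close>, so the independence of these two blocks
    of \<open>D\<close> carries over to them.\<close>
  have V_restrict: "V i (?R ?J \<omega>) = V i (?D \<omega>)" for i \<omega>
    unfolding V_def by (intro prod.cong) auto
  have S_restrict: "S (?R ?J \<omega>) = S (?D \<omega>)" for \<omega>
    unfolding S_def a_def b_def V_restrict ..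
  have "indep_var borel (E \<circ> ?R {j}) borel (S \<circ> ?R ?J)"
    by (rule indep_var_compose[OF indep_var_restrict[OF indep]]) auto
  also have "E \<circ> ?R {j} = (\<lambda>\<omega>. E (?D \<omega>))" by (simp add: E_def comp_def)
  also have "S \<circ> ?R ?J = (\<lambda>\<omega>. S (?D \<omega>))" by (simp add: comp_def S_restrict)
  finally have ind: "indep_var borel (\<lambda>\<omega>. E (?D \<omega>)) borel (\<lambda>\<omega>. S (?D \<omega>))" .
  have E_int: "integrable M (\<lambda>\<omega>. E (?D \<omega>))" and E_0: "(\<integral>\<omega>. E (?D \<omega>) \<partial>M) = 0"
    unfolding E_def using W_integrable W_integral by simp_all
  have S_int: "integrable M (\<lambda>\<omega>. S (?D \<omega>))"
  proof (rule Bochner_Integration.integrable_bound)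
    have "integrable M (\<lambda>\<omega>. b (?D \<omega>) i)" for i
      unfolding b_def V_def using W_prod_integrable[of "{..i} - {j}" s] by (cases "i < j") auto
    then show "integrable M (\<lambda>\<omega>. K * (\<Sum>i\<le>N. b (?D \<omega>) i))" by simp
    show "(\<lambda>\<omega>. S (?D \<omega>)) \<in> borel_measurable M"
      using indep_var_rv2[OF ind] .
    have "\<bar>S x\<bar> \<le> K * (\<Sum>i\<le>N. b x i)" for x
      unfolding S_def by (rule \<Phi>'_bound[OF b])
    then show "AE \<omega> in M. norm (S (?D \<omega>)) \<le> norm (K * (\<Sum>i\<le>N. b (?D \<omega>) i))"
      by (intro AE_I2) (fastforce intro: order_trans[OF _ abs_ge_self])
  qed
  have "0 = (\<integral>\<omega>. S (?D \<omega>) * E (?D \<omega>) \<partial>M)"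
    using indep_var_lebesgue_integral[OF ind E_int S_int] E_0 by (simp add: mult.commute)
  also have "\<dots> \<le> (\<integral>\<omega>. \<Phi> (\<lambda>i. Y (s(j := r)) i (?D \<omega>)) - \<Phi> (\<lambda>i. Y s i (?D \<omega>)) \<partial>M)"
    using indep_var_integrable[OF ind E_int S_int] \<Phi>_Y_integrable tangent
    by (intro integral_mono) (auto simp: mult.commute)
  also have "\<dots> = (\<integral>\<omega>. \<Phi> (\<lambda>i. Y (s(j := r)) i (?D \<omega>)) \<partial>M) - (\<integral>\<omega>. \<Phi> (\<lambda>i. Y s i (?D \<omega>)) \<partial>M)"
    by (intro Bochner_Integration.integral_diff \<Phi>_Y_integrable)
  finally show ?thesis by simp
qed

lemma expectation_mono:
  assumes "0 \<le> \<sigma>" "\<sigma> < \<sigma>'"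
  shows "(\<integral>\<omega>. \<Phi> (\<lambda>i. Y (\<lambda>_. \<sigma>) i (\<lambda>k. D k \<omega>)) \<partial>M) \<le> (\<integral>\<omega>. \<Phi> (\<lambda>i. Y (\<lambda>_. \<sigma>') i (\<lambda>k. D k \<omega>)) \<partial>M)"
proof -
  \<comment> \<open>The first \<open>m\<close> parameters are already raised. Only coordinates up to
    \<open>N\<close> enter \<Phi>, and these contain factors up to \<open>N\<close>, so
    \<open>Suc N\<close> steps are enough.\<close>
  define s where "s m k = (if k < m then \<sigma>' else \<sigma>)" for m k :: nat
  have "(\<integral>\<omega>. \<Phi> (\<lambda>i. Y (s 0) i (\<lambda>k. D k \<omega>)) \<partial>M) \<le> (\<integral>\<omega>. \<Phi> (\<lambda>i. Y (s m) i (\<lambda>k. D k \<omega>)) \<partial>M)" for m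
  proof (induction m)
    case (Suc m)
    have eq: "s (Suc m) = (s m)(m := \<sigma>')" by (auto simp: s_def fun_eq_iff less_Suc_eq)
    have "(\<integral>\<omega>. \<Phi> (\<lambda>i. Y (s m) i (\<lambda>k. D k \<omega>)) \<partial>M)
        \<le> (\<integral>\<omega>. \<Phi> (\<lambda>i. Y (s (Suc m)) i (\<lambda>k. D k \<omega>)) \<partial>M)"
      unfolding eq by (rule expectation_mono_one_parameter) (use assms in \<open>auto simp: s_def\<close>)
    with Suc.IH show ?case by (rule order_trans)
  qed simp
  from this[of "Suc N"]
  have "(\<integral>\<omega>. \<Phi> (\<lambda>i. Y (s 0) i (\<lambda>k. D k \<omega>)) \<partial>M)
      \<le> (\<integral>\<omega>. \<Phi> (\<lambda>i. Y (s (Suc N)) i (\<lambda>k. D k \<omega>)) \<partial>M)" .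
  moreover have "\<Phi> (\<lambda>i. Y (s (Suc N)) i x) = \<Phi> (\<lambda>i. Y (\<lambda>_. \<sigma>') i x)" for x
    by (intro \<Phi>_cong) (auto simp: Y_def s_def intro!: prod.cong)
  moreover have "s 0 = (\<lambda>_. \<sigma>)" by (simp add: s_def fun_eq_iff)
  ultimately show ?thesis by (simp only:)
qed

end

section \<open>Functionals restricted to step paths\<close>

context cadlag_functional
begin

lemma F_line_has_real_derivative:
  assumes a: "a \<in> cadlag T" and b: "b \<in> cadlag T"
  shows "((\<lambda>w. F (\<lambda>s. a s + w * b s)) has_real_derivative
    (\<integral>s. G s (\<lambda>s. a s + w * b s) * b s \<partial>\<mu>)) (at w)"
proof -
  obtain B where B: "B \<ge> 0" "\<And>t. t \<in> {0..T} \<Longrightarrow> \<bar>b t\<bar> \<le> B" using cadlag_bounded[OF b] by blast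
  show ?thesis
  proof (rule F_path_has_real_derivative[of 1 w "\<lambda>w s. a s + w * b s" B])
    fix v s assume "s \<in> {0..T}"
    have "\<bar>(a s + v * b s) - (a s + w * b s)\<bar> = \<bar>v - w\<bar> * \<bar>b s\<bar>"
      by (simp add: abs_mult[symmetric] algebra_simps)
    also have "\<dots> \<le> \<bar>v - w\<bar> * B" using B \<open>s \<in> {0..T}\<close> by (intro mult_left_mono) auto
    finally show "\<bar>(a s + v * b s) - (a s + w * b s)\<bar> \<le> \<bar>v - w\<bar> * B" .
  qed (use B cadlag_affine[OF a b] in \<open>auto intro!: derivative_eq_intros\<close>)
qed

lemma step_coordinate_lipschitz:
  "coordinate_lipschitz (\<lambda>y. F (\<lambda>t. y (grid_index n t))) (\<bar>C\<bar> * mass) (grid_index n T)"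
proof
  show "0 \<le> \<bar>C\<bar> * mass" by (simp add: mass_nonneg)
next
  fix y z :: "nat \<Rightarrow> real"
  let ?S = "\<Sum>i\<le>grid_index n T. \<bar>y i - z i\<bar>"
  have "\<bar>F (\<lambda>t. y (grid_index n t)) - F (\<lambda>t. z (grid_index n t))\<bar>
      \<le> \<bar>C\<bar> * Lp_norm \<mu> p (\<lambda>t. y (grid_index n t) - z (grid_index n t))"
    by (intro F_lipschitz step_function_cadlag)
  also have "Lp_norm \<mu> p (\<lambda>t. y (grid_index n t) - z (grid_index n t)) \<le> ?S * mass"
  proof (rule Lp_norm_le_bound)
    show "\<bar>y (grid_index n t) - z (grid_index n t)\<bar> \<le> ?S" if "t \<in> {0..T}" for t
      using that grid_index_mono[of t T n]
      by (intro member_le_sum[of "grid_index n t" _ "\<lambda>i. \<bar>y i - z i\<bar>"]) auto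
  qed (auto intro: sum_nonneg)
  finally show "\<bar>F (\<lambda>t. y (grid_index n t)) - F (\<lambda>t. z (grid_index n t))\<bar> \<le> \<bar>C\<bar> * mass * ?S"
    by (simp add: mult_left_mono mult_right_mono mult_ac)
qed

lemma step_directionally_convex:
  assumes mono: "nondecreasing_gradient T G"
  shows "directionally_convex (\<lambda>y. F (\<lambda>t. y (grid_index n t))) (\<bar>C\<bar> * mass) (grid_index n T)
    (\<lambda>y b w. \<integral>s. G s (\<lambda>t. y (grid_index n t) + w * b (grid_index n t)) * b (grid_index n s) \<partial>\<mu>)"
proof (intro directionally_convex.intro step_coordinate_lipschitz, unfold_locales)
  fix y b :: "nat \<Rightarrow> real" and w
  show "((\<lambda>w. F (\<lambda>t. y (grid_index n t) + w * b (grid_index n t))) has_real_derivative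
     (\<integral>s. G s (\<lambda>t. y (grid_index n t) + w * b (grid_index n t)) * b (grid_index n s) \<partial>\<mu>)) (at w)"
    by (rule F_line_has_real_derivative[OF step_function_cadlag step_function_cadlag])
next
  fix y b :: "nat \<Rightarrow> real" and w w' :: real
  assume b: "\<And>i. 0 \<le> b i" and "w \<le> w'"
  have c: "(\<lambda>t. y (grid_index n t) + w * b (grid_index n t)) \<in> cadlag T" for w
    by (rule cadlag_affine[OF step_function_cadlag step_function_cadlag])
  have "G s (\<lambda>t. y (grid_index n t) + w * b (grid_index n t))
      \<le> G s (\<lambda>t. y (grid_index n t) + w' * b (grid_index n t))" if "s \<in> {0..T}" for s
  proof -
    have "\<forall>r\<in>{0..T}. y (grid_index n r) + w * b (grid_index n r)
        \<le> y (grid_index n r) + w' * b (grid_index n r)"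
      by (intro ballI add_left_mono mult_right_mono \<open>w \<le> w'\<close> b)
    with mono[unfolded nondecreasing_gradient_def, THEN bspec, OF that, THEN bspec, OF c[of w],
        THEN bspec, OF c[of w']]
    show ?thesis by (rule mp)
  qed
  note G_le = this
  show "(\<integral>s. G s (\<lambda>t. y (grid_index n t) + w * b (grid_index n t)) * b (grid_index n s) \<partial>\<mu>)
      \<le> (\<integral>s. G s (\<lambda>t. y (grid_index n t) + w' * b (grid_index n t)) * b (grid_index n s) \<partial>\<mu>)"
  proof (rule integral_mono)
    show "integrable \<mu> (\<lambda>s. G s (\<lambda>t. y (grid_index n t) + w * b (grid_index n t)) * b (grid_index n s))" for w
      by (rule integrable_gradient_mult[OF c[of w] step_function_cadlag[of b n]])
    then show "integrable \<mu> (\<lambda>s. G s (\<lambda>t. y (grid_index n t) + w' * b (grid_index n t)) * b (grid_index n s))" .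
    fix s assume "s \<in> space \<mu>"
    then have s: "s \<in> {0..T}" by (simp only: space_\<mu>)
    show "G s (\<lambda>t. y (grid_index n t) + w * b (grid_index n t)) * b (grid_index n s)
        \<le> G s (\<lambda>t. y (grid_index n t) + w' * b (grid_index n t)) * b (grid_index n s)"
      by (rule mult_right_mono[OF G_le[OF s] b])
  qed
qed

end

section \<open>Exponentials of processes with independent increments\<close>

text \<open>From 1 + z <= exp z comes exp a - exp b <= (a - b) exp a. Both exponents are at most
  \<open>(\<bar>\<sigma>\<bar> + 1) * \<bar>x\<bar>\<close>, and one more
  \<open>\<bar>x\<bar>\<close> in the exponent absorbs the linear factor. The majorant of the
  quotient does not depend on \<open>v\<close>, as domination requires.\<close>

lemma exp_mult_diff_le:
  fixes v \<sigma> x :: real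
  assumes "\<bar>v - \<sigma>\<bar> \<le> 1"
  shows "\<bar>exp (v * x) - exp (\<sigma> * x)\<bar> \<le> \<bar>v - \<sigma>\<bar> * exp ((\<bar>\<sigma>\<bar> + 2) * \<bar>x\<bar>)"
proof -
  have one_sided: "exp a - exp b \<le> \<bar>a - b\<bar> * exp c" if "a \<le> c" for a b c :: real
  proof -
    have "1 + (b - a) \<le> exp (b - a)" by (rule exp_ge_add_one_self)
    then have "exp a * (1 + (b - a)) \<le> exp a * exp (b - a)" by (intro mult_left_mono) auto
    also have "exp a * exp (b - a) = exp b" by (simp add: exp_add[symmetric])
    finally have "exp a - exp b \<le> (a - b) * exp a" by (simp add: algebra_simps)
    also have "\<dots> \<le> \<bar>a - b\<bar> * exp c" using that by (intro mult_mono) auto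
    finally show ?thesis .
  qed
  let ?c = "(\<bar>\<sigma>\<bar> + 1) * \<bar>x\<bar>"
  have vx: "v * x \<le> ?c"
  proof -
    have "v * x \<le> \<bar>v\<bar> * \<bar>x\<bar>" by (metis abs_ge_self abs_mult)
    also have "\<dots> \<le> ?c" using assms by (intro mult_right_mono) auto
    finally show ?thesis .
  qed
  have sx: "\<sigma> * x \<le> ?c"
  proof -
    have "\<sigma> * x \<le> \<bar>\<sigma>\<bar> * \<bar>x\<bar>" by (metis abs_ge_self abs_mult)
    also have "\<dots> \<le> ?c" by (intro mult_right_mono) auto
    finally show ?thesis .
  qed
  have "\<bar>exp (v * x) - exp (\<sigma> * x)\<bar> \<le> \<bar>v * x - \<sigma> * x\<bar> * exp ?c"
    using one_sided[OF vx, of "\<sigma> * x"] one_sided[OF sx, of "v * x"]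
    by (intro abs_leI) (simp_all add: abs_minus_commute)
  also have "\<bar>v * x - \<sigma> * x\<bar> = \<bar>v - \<sigma>\<bar> * \<bar>x\<bar>" by (simp add: abs_mult[symmetric] algebra_simps)
  also have "\<bar>v - \<sigma>\<bar> * \<bar>x\<bar> * exp ?c \<le> \<bar>v - \<sigma>\<bar> * exp \<bar>x\<bar> * exp ?c"
    by (intro mult_right_mono mult_left_mono order_trans[OF _ exp_ge_add_one_self]) auto
  also have "\<dots> = \<bar>v - \<sigma>\<bar> * exp ((\<bar>\<sigma>\<bar> + 2) * \<bar>x\<bar>)"
    by (simp add: exp_add[symmetric] algebra_simps)
  finally show ?thesis .
qed

lemma exp_abs_le: "exp (c * \<bar>x\<bar>) \<le> exp (c * x) + exp (- c * x)" for c x :: real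
  by (cases "x \<ge> 0") (auto simp: abs_if)

locale exponential_process = prob_space M for M :: "'w measure" +
  fixes T :: real and X :: "real \<Rightarrow> 'w \<Rightarrow> real"
  assumes T_pos: "T > 0"
    and X_process: "cadlag_process M T X"
    and X_increments: "independent_increments M T X"
    and exp_X_integrable: "\<And>u t. t \<in> {0..T} \<Longrightarrow> integrable M (\<lambda>\<omega>. exp (u * X t \<omega>))"
    and exp_moment_bounds: "\<And>u. \<exists>a b. 0 < a \<and> (\<forall>t\<in>{0..T}. a \<le> exp_moment M X u t \<and> exp_moment M X u t \<le> b)"
begin

abbreviation L where "L \<equiv> exp_moment M X"

lemma X_measurable: "t \<in> {0..T} \<Longrightarrow> X t \<in> borel_measurable M"
  using X_process by (simp add: cadlag_process_def)

lemma X_cadlag: "\<omega> \<in> space M \<Longrightarrow> (\<lambda>t. X t \<omega>) \<in> cadlag T"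
  using X_process by (simp add: cadlag_process_def)

lemma L_pos: "t \<in> {0..T} \<Longrightarrow> L u t > 0"
  using exp_moment_bounds[of u] by force

lemma normalized_exp_eq:
  "t \<in> {0..T} \<Longrightarrow> normalized_exp M X u \<omega> t = exp (u * X t \<omega>) / L u t"
  using L_pos[of t u] by (simp add: normalized_exp_def log_exp_moment_def exp_diff)

lemma exp_abs_X_integrable: "t \<in> {0..T} \<Longrightarrow> integrable M (\<lambda>\<omega>. exp (c * \<bar>X t \<omega>\<bar>))"
proof (rule Bochner_Integration.integrable_bound)
  assume t: "t \<in> {0..T}"
  show "integrable M (\<lambda>\<omega>. exp (c * X t \<omega>) + exp (- c * X t \<omega>))"
    by (intro Bochner_Integration.integrable_add exp_X_integrable t)
  show "(\<lambda>\<omega>. exp (c * \<bar>X t \<omega>\<bar>)) \<in> borel_measurable M"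
    using X_measurable[OF t] by measurable
  show "AE \<omega> in M. norm (exp (c * \<bar>X t \<omega>\<bar>)) \<le> norm (exp (c * X t \<omega>) + exp (- c * X t \<omega>))"
    using exp_abs_le[THEN order_trans, OF abs_ge_self] by (intro AE_I2) (simp only: real_norm_def abs_exp_cancel)
qed

lemma exp_abs_moment_bounded:
  obtains b where "b \<ge> 0" "\<And>t. t \<in> {0..T} \<Longrightarrow> (\<integral>\<omega>. exp (c * \<bar>X t \<omega>\<bar>) \<partial>M) \<le> b"
proof -
  obtain b1 where b1: "\<And>t. t \<in> {0..T} \<Longrightarrow> L c t \<le> b1" using exp_moment_bounds[of c] by blast
  obtain b2 where b2: "\<And>t. t \<in> {0..T} \<Longrightarrow> L (- c) t \<le> b2" using exp_moment_bounds[of "- c"] by blast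
  have le: "(\<integral>\<omega>. exp (c * \<bar>X t \<omega>\<bar>) \<partial>M) \<le> b1 + b2" if t: "t \<in> {0..T}" for t
  proof -
    have "(\<integral>\<omega>. exp (c * \<bar>X t \<omega>\<bar>) \<partial>M) \<le> (\<integral>\<omega>. exp (c * X t \<omega>) + exp (- c * X t \<omega>) \<partial>M)"
      by (intro integral_mono exp_abs_X_integrable Bochner_Integration.integrable_add exp_X_integrable t exp_abs_le)
    also have "\<dots> = L c t + L (- c) t"
      unfolding exp_moment_def by (intro Bochner_Integration.integral_add exp_X_integrable t)
    finally show ?thesis using b1[OF t] b2[OF t] by linarith
  qed
  show ?thesis
    by (rule that[OF abs_ge_zero order_trans[OF le abs_ge_self]])
qed

text \<open>Squaring doubles the parameter, and the moments at \<open>2 * u\<close> are bounded over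
  time, so the exponentials are bounded in L^2. The limit \<open>Z\<close> may be a left limit of
  the process and not one of its values.\<close>

lemma L_limit:
  assumes S: "\<And>n. S n \<in> {0..T}" and lim: "\<And>\<omega>. \<omega> \<in> space M \<Longrightarrow> (\<lambda>n. X (S n) \<omega>) \<longlonglongrightarrow> Z \<omega>"
  shows "(\<lambda>n. L u (S n)) \<longlonglongrightarrow> (\<integral>\<omega>. exp (u * Z \<omega>) \<partial>M)"
proof -
  obtain b where b: "\<And>t. t \<in> {0..T} \<Longrightarrow> L (2 * u) t \<le> b" using exp_moment_bounds[of "2 * u"] by blast
  have sq: "(exp (u * x))\<^sup>2 = exp (2 * u * x)" for x by (simp add: power2_eq_square exp_add[symmetric])
  show ?thesis
    unfolding exp_moment_def
  proof (rule integral_limit_bounded_L2[where B = b])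
    show "(\<lambda>\<omega>. exp (u * X (S n) \<omega>)) \<in> borel_measurable M" for n
      using X_measurable[OF S] by measurable
    show "(\<lambda>n. exp (u * X (S n) \<omega>)) \<longlonglongrightarrow> exp (u * Z \<omega>)" if "\<omega> \<in> space M" for \<omega>
      by (intro tendsto_intros lim that)
    show "integrable M (\<lambda>\<omega>. (exp (u * X (S n) \<omega>))\<^sup>2)" for n
      unfolding sq by (rule exp_X_integrable[OF S])
    show "(\<integral>\<omega>. (exp (u * X (S n) \<omega>))\<^sup>2 \<partial>M) \<le> b" for n
      using b[OF S[of n]] unfolding sq exp_moment_def .
  qed
qed

lemma L_tendsto_right:
  assumes "t \<in> {0..<T}"
  shows "(L u \<longlongrightarrow> L u t) (at_right t)"
proof (rule tendsto_at_right_sequentially[of t T])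
  fix S assume S: "\<And>n. t < S n" "\<And>n. S n < T" "S \<longlonglongrightarrow> t"
  have "filterlim S (at_right t) sequentially"
    using S by (simp add: filterlim_at less_imp_neq[THEN not_sym])
  then have "(\<lambda>n. X (S n) \<omega>) \<longlonglongrightarrow> X t \<omega>" if "\<omega> \<in> space M" for \<omega>
  proof (rule filterlim_compose[rotated])
    show "((\<lambda>t. X t \<omega>) \<longlongrightarrow> X t \<omega>) (at_right t)"
      using X_cadlag[OF that] assms by (simp add: cadlag_def)
  qed
  moreover have "S n \<in> {0..T}" for n using S(1,2)[of n] assms by auto
  ultimately show "(\<lambda>n. L u (S n)) \<longlonglongrightarrow> L u t"
    unfolding exp_moment_def[of M X u t] by (intro L_limit)
qed (use assms in auto)

text \<open>The process may jump at a fixed time, so the limit is the moment of the left limit of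
  the path and can differ from \<open>L u t\<close>. It is positive because \<open>L u\<close> is
  bounded away from 0; the logarithm needs this.\<close>

lemma L_tendsto_left:
  assumes t: "t \<in> {0<..T}"
  obtains l where "l > 0" "(L u \<longlongrightarrow> l) (at_left t)"
proof -
  have "\<exists>l. ((\<lambda>t. X t \<omega>) \<longlongrightarrow> l) (at_left t)" if "\<omega> \<in> space M" for \<omega>
    using X_cadlag[OF that] t by (simp add: cadlag_def)
  then obtain Z where Z: "\<And>\<omega>. \<omega> \<in> space M \<Longrightarrow> ((\<lambda>t. X t \<omega>) \<longlongrightarrow> Z \<omega>) (at_left t)" by metis
  define l where "l = (\<integral>\<omega>. exp (u * Z \<omega>) \<partial>M)"
  have lim: "(L u \<longlongrightarrow> l) (at_left t)"
  proof (rule tendsto_at_left_sequentially[of 0 t])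
    fix S assume S: "\<And>n. S n < t" "\<And>n. 0 < S n" "S \<longlonglongrightarrow> t"
    have "filterlim S (at_left t) sequentially"
      using S by (simp add: filterlim_at less_imp_neq)
    then have "(\<lambda>n. X (S n) \<omega>) \<longlonglongrightarrow> Z \<omega>" if "\<omega> \<in> space M" for \<omega>
      using Z[OF that] by (rule filterlim_compose[rotated])
    moreover have "S n \<in> {0..T}" for n using S(1,2)[of n] t by auto
    ultimately show "(\<lambda>n. L u (S n)) \<longlonglongrightarrow> l"
      unfolding l_def by (intro L_limit)
  qed (use t in auto)
  obtain a where a: "a > 0" "\<And>t. t \<in> {0..T} \<Longrightarrow> a \<le> L u t" using exp_moment_bounds[of u] by blast
  have "a \<le> l"
  proof (rule tendsto_lowerbound[OF lim])
    show "\<forall>\<^sub>F s in at_left t. a \<le> L u s"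
      unfolding eventually_at_left_field using t a(2) by (intro exI[of _ 0]) auto
  qed simp
  then show ?thesis using a(1) lim that[of l] by simp
qed

lemma normalized_exp_cadlag:
  assumes \<omega>: "\<omega> \<in> space M"
  shows "normalized_exp M X u \<omega> \<in> cadlag T"
proof -
  have "(normalized_exp M X u \<omega> \<longlongrightarrow> normalized_exp M X u \<omega> t) (at_right t)" if t: "t \<in> {0..<T}" for t
  proof -
    have X: "((\<lambda>t. X t \<omega>) \<longlongrightarrow> X t \<omega>) (at_right t)"
      using X_cadlag[OF \<omega>] t by (simp add: cadlag_def)
    show ?thesis
      unfolding normalized_exp_def[abs_def] log_exp_moment_def
      using t L_pos[of t u] by (intro tendsto_intros X L_tendsto_right) auto
  qed
  moreover have "\<exists>l. (normalized_exp M X u \<omega> \<longlongrightarrow> l) (at_left t)" if t: "t \<in> {0<..T}" for t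
  proof -
    have "\<exists>l. ((\<lambda>t. X t \<omega>) \<longlongrightarrow> l) (at_left t)"
      using X_cadlag[OF \<omega>] t by (simp add: cadlag_def)
    then obtain x where X: "((\<lambda>t. X t \<omega>) \<longlongrightarrow> x) (at_left t)" by blast
    obtain l where l: "l > 0" "(L u \<longlongrightarrow> l) (at_left t)" by (rule L_tendsto_left[OF t])
    have "(normalized_exp M X u \<omega> \<longlongrightarrow> exp (u * x - ln l)) (at_left t)"
      unfolding normalized_exp_def[abs_def] log_exp_moment_def
      using l(1) by (intro tendsto_intros X l(2)) auto
    then show ?thesis by blast
  qed
  ultimately show ?thesis by (simp add: cadlag_def)
qed

lemma L_Lipschitz:
  obtains K where "K \<ge> 0"
    "\<And>v t. \<bar>v - \<sigma>\<bar> \<le> 1 \<Longrightarrow> t \<in> {0..T} \<Longrightarrow> \<bar>L v t - L \<sigma> t\<bar> \<le> \<bar>v - \<sigma>\<bar> * K"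
proof -
  let ?c = "\<bar>\<sigma>\<bar> + 2"
  obtain K where K: "K \<ge> 0" "\<And>t. t \<in> {0..T} \<Longrightarrow> (\<integral>\<omega>. exp (?c * \<bar>X t \<omega>\<bar>) \<partial>M) \<le> K"
    by (rule exp_abs_moment_bounded[of ?c]) blast
  show ?thesis
  proof (rule that[OF K(1)])
    fix v t assume v: "\<bar>v - \<sigma>\<bar> \<le> 1" and t: "t \<in> {0..T}"
    have "\<bar>L v t - L \<sigma> t\<bar> = \<bar>\<integral>\<omega>. exp (v * X t \<omega>) - exp (\<sigma> * X t \<omega>) \<partial>M\<bar>"
      unfolding exp_moment_def by (simp add: exp_X_integrable[OF t])
    also have "\<dots> \<le> (\<integral>\<omega>. \<bar>exp (v * X t \<omega>) - exp (\<sigma> * X t \<omega>)\<bar> \<partial>M)"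
      by (rule integral_abs_bound)
    also have "\<dots> \<le> (\<integral>\<omega>. \<bar>v - \<sigma>\<bar> * exp (?c * \<bar>X t \<omega>\<bar>) \<partial>M)"
      using exp_X_integrable[OF t] exp_abs_X_integrable[OF t] exp_mult_diff_le[OF v]
      by (intro integral_mono integrable_abs Bochner_Integration.integrable_diff integrable_mult_right) auto
    also have "\<dots> = \<bar>v - \<sigma>\<bar> * (\<integral>\<omega>. exp (?c * \<bar>X t \<omega>\<bar>) \<partial>M)" by simp
    also have "\<dots> \<le> \<bar>v - \<sigma>\<bar> * K" using K(2)[OF t] by (intro mult_left_mono) auto
    finally show "\<bar>L v t - L \<sigma> t\<bar> \<le> \<bar>v - \<sigma>\<bar> * K" .
  qed
qed

lemma L_has_real_derivative:
  assumes t: "t \<in> {0..T}"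
  shows "((\<lambda>v. L v t) has_real_derivative (\<integral>\<omega>. X t \<omega> * exp (\<sigma> * X t \<omega>) \<partial>M)) (at \<sigma>)"
  unfolding exp_moment_def
proof (rule has_real_derivative_integral[of 1])
  show "integrable M (\<lambda>\<omega>. exp ((\<bar>\<sigma>\<bar> + 2) * \<bar>X t \<omega>\<bar>))" by (rule exp_abs_X_integrable[OF t])
qed (use exp_X_integrable[OF t] exp_mult_diff_le in \<open>auto intro!: derivative_eq_intros\<close>)

lemma normalized_exp_has_real_derivative:
  assumes t: "t \<in> {0..T}"
  shows "\<exists>d. ((\<lambda>v. normalized_exp M X v \<omega> t) has_real_derivative d) (at \<sigma>)"
proof -
  have "((\<lambda>v. exp (v * X t \<omega>)) has_real_derivative X t \<omega> * exp (\<sigma> * X t \<omega>)) (at \<sigma>)"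
    by (auto intro!: derivative_eq_intros)
  from DERIV_divide[OF this L_has_real_derivative[OF t]] L_pos[OF t, of \<sigma>]
  show ?thesis unfolding normalized_exp_eq[OF t] by (intro exI) simp
qed

text \<open>A quotient of two functions that are Lipschitz in the parameter. The constants depend
  neither on the time nor on the path: the randomness is confined to the exponential factor.\<close>

lemma normalized_exp_Lipschitz:
  obtains \<delta> K where "\<delta> > 0" "\<delta> \<le> 1" "K \<ge> 0"
    "\<And>v t \<omega>. \<bar>v - \<sigma>\<bar> < \<delta> \<Longrightarrow> t \<in> {0..T} \<Longrightarrow>
      \<bar>normalized_exp M X v \<omega> t - normalized_exp M X \<sigma> \<omega> t\<bar>
        \<le> \<bar>v - \<sigma>\<bar> * (K * exp ((\<bar>\<sigma>\<bar> + 2) * \<bar>X t \<omega>\<bar>))"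
proof -
  obtain a where a: "a > 0" "\<And>t. t \<in> {0..T} \<Longrightarrow> a \<le> L \<sigma> t" using exp_moment_bounds[of \<sigma>] by blast
  obtain K where K: "K \<ge> 0"
    "\<And>v t. \<bar>v - \<sigma>\<bar> \<le> 1 \<Longrightarrow> t \<in> {0..T} \<Longrightarrow> \<bar>L v t - L \<sigma> t\<bar> \<le> \<bar>v - \<sigma>\<bar> * K"
    by (rule L_Lipschitz) blast
  \<comment> \<open>The lower bound on \<open>L\<close> is given for each parameter separately.
    Within this radius the Lipschitz bound keeps \<open>L v t\<close> above \<open>a / 2\<close> for
    all times together. The summands of \<open>B\<close> come from the change of the numerator and
    from that of the denominator.\<close>
  define \<delta> where "\<delta> = min 1 (a / (2 * (K + 1)))"
  define B where "B = 2 / a + 2 * K / a\<^sup>2"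
  show ?thesis
  proof (rule that[of \<delta> B])
    show "\<delta> > 0" "\<delta> \<le> 1" "B \<ge> 0" using a(1) K(1) by (auto simp: \<delta>_def B_def)
    fix v t \<omega> assume v: "\<bar>v - \<sigma>\<bar> < \<delta>" and t: "t \<in> {0..T}"
    let ?x = "X t \<omega>" and ?e = "exp ((\<bar>\<sigma>\<bar> + 2) * \<bar>X t \<omega>\<bar>)" and ?d = "\<bar>v - \<sigma>\<bar>"
    have v1: "?d \<le> 1" using v by (simp add: \<delta>_def)
    have "?d * K \<le> a / (2 * (K + 1)) * K" using v K(1) by (intro mult_right_mono) (auto simp: \<delta>_def)
    also have "\<dots> \<le> a / 2" using a(1) K(1) by (simp add: field_simps)
    finally have "a / 2 \<le> L v t" using K(2)[OF v1 t] a(2)[OF t] by linarith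
    note Lv = this and L\<sigma> = a(2)[OF t]
    have pos: "L v t > 0" "L \<sigma> t > 0" using Lv L\<sigma> a(1) by linarith+
    have s_le: "exp (\<sigma> * ?x) \<le> ?e"
    proof -
      have "\<sigma> * ?x \<le> \<bar>\<sigma>\<bar> * \<bar>?x\<bar>" by (metis abs_ge_self abs_mult)
      also have "\<dots> \<le> (\<bar>\<sigma>\<bar> + 2) * \<bar>?x\<bar>" by (intro mult_right_mono) auto
      finally show ?thesis by simp
    qed
    have split: "exp (v * ?x) / L v t - exp (\<sigma> * ?x) / L \<sigma> t
        = (exp (v * ?x) - exp (\<sigma> * ?x)) / L v t + exp (\<sigma> * ?x) * (L \<sigma> t - L v t) / (L v t * L \<sigma> t)"
      using pos by (simp add: field_simps)
    have "\<bar>(exp (v * ?x) - exp (\<sigma> * ?x)) / L v t\<bar> \<le> (?d * ?e) / (a / 2)"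
      unfolding abs_divide using exp_mult_diff_le[OF v1, of ?x] Lv a(1) pos by (intro frac_le) auto
    moreover have "\<bar>exp (\<sigma> * ?x) * (L \<sigma> t - L v t) / (L v t * L \<sigma> t)\<bar> \<le> (?e * (?d * K)) / (a / 2 * a)"
      unfolding abs_divide abs_mult
      using s_le K(2)[OF v1 t] Lv L\<sigma> a(1) pos K(1)
      by (intro frac_le mult_mono) (auto simp: abs_minus_commute)
    moreover have "(?d * ?e) / (a / 2) + (?e * (?d * K)) / (a / 2 * a) = ?d * (B * ?e)"
      using a(1) by (simp add: B_def field_simps power2_eq_square)
    ultimately show "\<bar>normalized_exp M X v \<omega> t - normalized_exp M X \<sigma> \<omega> t\<bar> \<le> ?d * (B * ?e)"
      unfolding normalized_exp_eq[OF t] split by linarith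
  qed
qed

lemma normalized_exp_bound:
  obtains K where "K \<ge> 0"
    "\<And>t \<omega>. t \<in> {0..T} \<Longrightarrow> \<bar>normalized_exp M X \<sigma> \<omega> t\<bar> \<le> K * exp (\<bar>\<sigma>\<bar> * \<bar>X t \<omega>\<bar>)"
proof -
  obtain a where a: "a > 0" "\<And>t. t \<in> {0..T} \<Longrightarrow> a \<le> L \<sigma> t" using exp_moment_bounds[of \<sigma>] by blast
  have "\<bar>normalized_exp M X \<sigma> \<omega> t\<bar> \<le> 1 / a * exp (\<bar>\<sigma>\<bar> * \<bar>X t \<omega>\<bar>)" if t: "t \<in> {0..T}" for t \<omega>
  proof -
    have "\<sigma> * X t \<omega> \<le> \<bar>\<sigma>\<bar> * \<bar>X t \<omega>\<bar>" by (metis abs_ge_self abs_mult)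
    then have "exp (\<sigma> * X t \<omega>) / L \<sigma> t \<le> exp (\<bar>\<sigma>\<bar> * \<bar>X t \<omega>\<bar>) / a"
      using a(1) a(2)[OF t] by (intro frac_le) auto
    then show ?thesis unfolding normalized_exp_eq[OF t] using L_pos[OF t, of \<sigma>] by simp
  qed
  then show ?thesis using that[of "1 / a"] a(1) by simp
qed

text \<open>The entry of index 0 is a value of the process and not a difference, so that the partial
  sums telescope to the process with its possibly random initial value.\<close>

definition increment :: "(nat \<Rightarrow> real) \<Rightarrow> nat \<Rightarrow> 'w \<Rightarrow> real" where
  "increment \<tau> j \<omega> = X (\<tau> j) \<omega> - (if j = 0 then 0 else X (\<tau> (j - 1)) \<omega>)"

lemma sum_increment: "(\<Sum>j\<le>i. increment \<tau> j \<omega>) = X (\<tau> i) \<omega>"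
  by (induction i) (auto simp: increment_def)

section \<open>Independence of the increments over a grid\<close>

context
  fixes \<tau> :: "nat \<Rightarrow> real"
  assumes \<tau>_in: "\<And>j. \<tau> j \<in> {0..T}" and \<tau>_mono: "\<And>i j. i \<le> j \<Longrightarrow> \<tau> i \<le> \<tau> j"
begin

lemma increment_measurable [measurable]: "increment \<tau> j \<in> borel_measurable M"
  unfolding increment_def[abs_def]
  using X_measurable[OF \<tau>_in] by (cases "j = 0") auto

text \<open>Places the joint event in the \<sigma>-field from which the next increment is
  independent. In the proof that \<sigma>-field is made into a measure space \<open>?N\<close>, so
  that measurability can be composed in it.\<close>

lemma increments_in_past:
  assumes A: "\<And>j. A j \<in> sets borel"
  shows "{\<omega> \<in> space M. \<forall>j\<le>m. increment \<tau> j \<omega> \<in> A j} \<in> past_events M X (\<tau> m)"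
proof -
  define G where "G = {X u -` A \<inter> space M | u A. u \<in> {0..\<tau> m} \<and> A \<in> sets borel}"
  have G: "G \<subseteq> Pow (space M)" by (auto simp: G_def)
  let ?N = "sigma (space M) G"
  have sets_N: "sets ?N = past_events M X (\<tau> m)"
    using G by (simp add: past_events_def G_def)
  have X_N: "X u \<in> borel_measurable ?N" if "u \<in> {0..\<tau> m}" for u
  proof (rule measurableI)
    fix A :: "real set" assume "A \<in> sets borel"
    then have "X u -` A \<inter> space M \<in> G" using that by (auto simp: G_def)
    then show "X u -` A \<inter> space ?N \<in> sets ?N" using G by auto
  qed simp
  have inc_N: "increment \<tau> j \<in> borel_measurable ?N" if "j \<le> m" for j
  proof -
    have "\<tau> i \<in> {0..\<tau> m}" if "i \<le> j" for i
      using \<tau>_in[of i] \<tau>_mono[of i m] that \<open>j \<le> m\<close> by auto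
    then show ?thesis
      unfolding increment_def[abs_def] by (cases "j = 0") (auto intro!: borel_measurable_diff X_N)
  qed
  have "{\<omega> \<in> space ?N. \<forall>j\<in>{..m}. increment \<tau> j \<omega> \<in> A j} \<in> sets ?N"
  proof (rule sets.sets_Collect_finite_All)
    fix j assume "j \<in> {..m}"
    then have "increment \<tau> j -` A j \<inter> space ?N \<in> sets ?N"
      using inc_N A by (intro measurable_sets) auto
    then show "{\<omega> \<in> space ?N. increment \<tau> j \<omega> \<in> A j} \<in> sets ?N"
      by (simp add: vimage_def Int_def conj_commute)
  qed simp
  moreover have "{\<omega> \<in> space ?N. \<forall>j\<in>{..m}. increment \<tau> j \<omega> \<in> A j}
      = {\<omega> \<in> space M. \<forall>j\<le>m. increment \<tau> j \<omega> \<in> A j}"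
    using G by auto
  ultimately show ?thesis by (simp only: sets_N)
qed

text \<open>Independence of one increment from the past becomes joint independence by induction: the
  last increment splits off, and the remaining ones form an event of the past.\<close>

lemma prob_increments:
  assumes A: "\<And>j. A j \<in> sets borel"
  shows "prob {\<omega> \<in> space M. \<forall>j\<le>m. increment \<tau> j \<omega> \<in> A j}
    = (\<Prod>j\<le>m. prob (increment \<tau> j -` A j \<inter> space M))"
proof (induction m)
  case 0
  show ?case by (simp add: vimage_def Int_def conj_commute)
next
  case (Suc m)
  let ?B = "increment \<tau> (Suc m) -` A (Suc m) \<inter> space M"
  let ?P = "{\<omega> \<in> space M. \<forall>j\<le>m. increment \<tau> j \<omega> \<in> A j}"
  have ind: "indep_set
      {(\<lambda>\<omega>. X (\<tau> (Suc m)) \<omega> - X (\<tau> m) \<omega>) -` A \<inter> space M | A. A \<in> sets borel} (past_events M X (\<tau> m))"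
    using X_increments \<tau>_in[of m] \<tau>_in[of "Suc m"] \<tau>_mono[of m "Suc m"]
    by (simp add: independent_increments_def)
  have "?B = (\<lambda>\<omega>. X (\<tau> (Suc m)) \<omega> - X (\<tau> m) \<omega>) -` A (Suc m) \<inter> space M"
    by (simp add: increment_def[abs_def])
  then have B: "?B \<in> {(\<lambda>\<omega>. X (\<tau> (Suc m)) \<omega> - X (\<tau> m) \<omega>) -` A \<inter> space M | A. A \<in> sets borel}"
    using A[of "Suc m"] by blast
  have "{\<omega> \<in> space M. \<forall>j\<le>Suc m. increment \<tau> j \<omega> \<in> A j} = ?B \<inter> ?P"
    by (auto simp: le_Suc_eq)
  then have "prob {\<omega> \<in> space M. \<forall>j\<le>Suc m. increment \<tau> j \<omega> \<in> A j} = prob ?B * prob ?P"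
    using indep_setD[OF ind B increments_in_past[OF A]] by simp
  then show ?case by (simp add: Suc.IH mult.commute)
qed

lemma increments_indep: "indep_vars (\<lambda>_. borel) (increment \<tau>) UNIV"
proof -
  have fin: "indep_vars (\<lambda>_. borel) (increment \<tau>) {..m}" for m
  proof (subst indep_vars_finite[where E = "\<lambda>_. sets borel"])
    show "\<forall>A\<in>{..m} \<rightarrow> sets borel. prob (\<Inter>j\<in>{..m}. increment \<tau> j -` A j \<inter> space M)
        = (\<Prod>j\<in>{..m}. prob (increment \<tau> j -` A j \<inter> space M))"
    proof
      fix A :: "nat \<Rightarrow> real set" assume A: "A \<in> {..m} \<rightarrow> sets borel"
      \<comment> \<open>\<open>prob_increments\<close> takes a Borel set at every index, but
        \<open>A\<close> is constrained only up to \<open>m\<close>.\<close>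
      define A' where "A' j = (if j \<le> m then A j else {})" for j
      have A': "A' j \<in> sets borel" for j using A by (auto simp: A'_def)
      have "(\<Inter>j\<in>{..m}. increment \<tau> j -` A j \<inter> space M)
          = {\<omega> \<in> space M. \<forall>j\<le>m. increment \<tau> j \<omega> \<in> A' j}"
        by (auto simp: A'_def)
      then show "prob (\<Inter>j\<in>{..m}. increment \<tau> j -` A j \<inter> space M)
          = (\<Prod>j\<in>{..m}. prob (increment \<tau> j -` A j \<inter> space M))"
        using prob_increments[of A' m, OF A'] by (simp add: A'_def)
    qed
    show "sets borel = sigma_sets (space borel) (sets borel)" by (rule sets.sigma_sets_eq[symmetric])
    show "Int_stable (sets borel)" by (rule sets.Int_stable)
  qed (auto simp: sets.space_closed[of borel, simplified])
  have "indep_sets (\<lambda>i. {increment \<tau> i -` A \<inter> space M | A. A \<in> sets borel}) UNIV"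
  proof (subst indep_sets_finite_index_sets, intro allI impI)
    fix J :: "nat set" assume "finite J" "J \<noteq> {}"
    then have "J \<subseteq> {..Max J}" by auto
    then show "indep_sets (\<lambda>i. {increment \<tau> i -` A \<inter> space M | A. A \<in> sets borel}) J"
      by (rule indep_sets_mono_index) (use fin[of "Max J"] in \<open>simp add: indep_vars_def2\<close>)
  qed
  then show ?thesis by (simp add: indep_vars_def2)
qed

lemma increments_exponentials: "independent_exponentials M (increment \<tau>)"
proof (unfold_locales, rule increments_indep)
  fix i u
  show "integrable M (\<lambda>\<omega>. exp (u * increment \<tau> i \<omega>))"
  proof (cases "i = 0")
    case True
    then show ?thesis using exp_X_integrable[OF \<tau>_in] by (simp add: increment_def)
  next
    case False
    \<comment> \<open>The pointwise inequality x y <= x^2 + y^2 reduces the moments of a difference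
      to those of the process at doubled parameters.\<close>
    have prod_le: "exp (u * (x - y)) \<le> exp (2 * u * x) + exp (- 2 * u * y)" for x y
    proof -
      have "exp (u * (x - y)) = exp (u * x) * exp (- u * y)"
        by (simp add: exp_add[symmetric] algebra_simps)
      also have "\<dots> \<le> (exp (u * x))\<^sup>2 + (exp (- u * y))\<^sup>2"
        using sum_squares_ge_zero[of "exp (u * x)" "exp (- u * y)"]
          zero_le_power2[of "exp (u * x) - exp (- u * y)"]
        by (simp add: power2_eq_square algebra_simps) (smt (verit) mult_nonneg_nonneg exp_ge_zero)
      also have "\<dots> = exp (2 * u * x) + exp (- 2 * u * y)"
        by (simp add: power2_eq_square exp_add[symmetric] mult.assoc)
      finally show ?thesis .
    qed
    show ?thesis
    proof (rule Bochner_Integration.integrable_bound)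
      show "integrable M (\<lambda>\<omega>. exp (2 * u * X (\<tau> i) \<omega>) + exp (- 2 * u * X (\<tau> (i - 1)) \<omega>))"
        by (intro Bochner_Integration.integrable_add exp_X_integrable \<tau>_in)
      show "(\<lambda>\<omega>. exp (u * increment \<tau> i \<omega>)) \<in> borel_measurable M" by measurable
      have "exp (u * increment \<tau> i \<omega>)
          \<le> exp (2 * u * X (\<tau> i) \<omega>) + exp (- 2 * u * X (\<tau> (i - 1)) \<omega>)" for \<omega>
        using False prod_le by (simp add: increment_def)
      then show "AE \<omega> in M. norm (exp (u * increment \<tau> i \<omega>))
          \<le> norm (exp (2 * u * X (\<tau> i) \<omega>) + exp (- 2 * u * X (\<tau> (i - 1)) \<omega>))"
        by (intro AE_I2) (simp only: real_norm_def abs_exp_cancel order_trans[OF _ abs_ge_self])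
    qed
  qed
qed

text \<open>The exponential of the telescoping sum is a product, and by independence so is its mean.
  Normalizing each factor is therefore the same as normalizing the exponential of the
  process.\<close>

lemma normalized_exp_product:
  "independent_exponentials.Y M (increment \<tau>) (\<lambda>_. u) i (\<lambda>k. increment \<tau> k \<omega>)
    = normalized_exp M X u \<omega> (\<tau> i)"
proof -
  interpret D: independent_exponentials M "increment \<tau>" by (rule increments_exponentials)
  have exp_sum': "(\<Prod>k\<le>i. exp (u * increment \<tau> k \<omega>)) = exp (u * X (\<tau> i) \<omega>)" for \<omega>
    by (simp add: exp_sum[symmetric] sum_distrib_left[symmetric] sum_increment)
  have "L u (\<tau> i) = (\<integral>\<omega>. (\<Prod>k\<le>i. exp (u * increment \<tau> k \<omega>)) \<partial>M)"
    by (simp add: exp_sum' exp_moment_def)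
  also have "\<dots> = (\<Prod>k\<le>i. \<integral>\<omega>. exp (u * increment \<tau> k \<omega>) \<partial>M)"
  proof (rule indep_vars_lebesgue_integral)
    show "indep_vars (\<lambda>_. borel) (\<lambda>k \<omega>. exp (u * increment \<tau> k \<omega>)) {..i}"
      by (rule indep_vars_compose2[OF indep_vars_subset[OF increments_indep]]) auto
  qed (auto intro: D.exp_integrable)
  finally show ?thesis
    by (simp add: D.Y_def D.W_def prod_dividef exp_sum' normalized_exp_eq[OF \<tau>_in])
qed

end

end

section \<open>Functionals of the normalized exponential\<close>

locale process_functional = cadlag_functional \<mu> T p F G C + P: exponential_process M T X
  for \<mu> :: "real measure" and T p :: real and F :: "(real \<Rightarrow> real) \<Rightarrow> real"
    and G :: "real \<Rightarrow> (real \<Rightarrow> real) \<Rightarrow> real" and C :: real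
    and M :: "'w measure" and X :: "real \<Rightarrow> 'w \<Rightarrow> real"
begin

abbreviation Z where "Z \<equiv> normalized_exp M X"

definition next_grid_point :: "nat \<Rightarrow> real \<Rightarrow> real" where
  "next_grid_point n t = grid_point T n (grid_index n t)"

lemma next_grid_point_in: "next_grid_point n t \<in> {0..T}"
  unfolding next_grid_point_def by (rule grid_point_in[OF T_pos])

lemma space_pair_\<mu>: "space (\<mu> \<Otimes>\<^sub>M M) = {0..T} \<times> space M"
  by (simp add: space_pair_measure space_\<mu>)

lemma X_grid_measurable:
  "(\<lambda>x. X (next_grid_point n (fst x)) (snd x)) \<in> borel_measurable (\<mu> \<Otimes>\<^sub>M M)"
  unfolding next_grid_point_def
proof (rule measurable_compose_countable[where f = "\<lambda>i x. X (grid_point T n i) (snd x)"])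
  show "(\<lambda>x. X (grid_point T n i) (snd x)) \<in> borel_measurable (\<mu> \<Otimes>\<^sub>M M)" for i
    by (rule measurable_compose[OF measurable_snd P.X_measurable[OF grid_point_in[OF T_pos]]])
  show "(\<lambda>x. grid_index n (fst x)) \<in> \<mu> \<Otimes>\<^sub>M M \<rightarrow>\<^sub>M count_space UNIV"
    by (rule measurable_compose[OF measurable_fst measurable_grid_index_\<mu>])
qed

text \<open>Joint measurability comes from right continuity: the sampled process uses countably many
  times, and it converges at every time.\<close>

lemma X_measurable_pair: "(\<lambda>x. X (fst x) (snd x)) \<in> borel_measurable (\<mu> \<Otimes>\<^sub>M M)"
proof (rule borel_measurable_LIMSEQ_real[OF _ X_grid_measurable])
  fix x assume "x \<in> space (\<mu> \<Otimes>\<^sub>M M)"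
  then have x: "fst x \<in> {0..T}" "snd x \<in> space M" by (auto simp: space_pair_\<mu>)
  show "(\<lambda>n. X (next_grid_point n (fst x)) (snd x)) \<longlonglongrightarrow> X (fst x) (snd x)"
    unfolding next_grid_point_def by (rule cadlag_grid_limit[OF P.X_cadlag[OF x(2)] x(1)])
qed

text \<open>Fubini's theorem turns bounds at single times into bounds for path integrals.
  Integrability at each time is asked for separately, as the integral of a non-integrable function
  is 0 and would satisfy many bounds vacuously.\<close>

lemma
  assumes meas: "(\<lambda>x. H (fst x) (snd x)) \<in> borel_measurable (\<mu> \<Otimes>\<^sub>M M)"
    and nonneg: "\<And>t \<omega>. 0 \<le> H t \<omega>"
    and int: "\<And>t. t \<in> {0..T} \<Longrightarrow> integrable M (H t)"
    and bound: "\<And>t. t \<in> {0..T} \<Longrightarrow> (\<integral>\<omega>. H t \<omega> \<partial>M) \<le> (b :: real)"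
  shows integrable_path_integral: "integrable M (\<lambda>\<omega>. \<integral>t. H t \<omega> \<partial>\<mu>)"
    and path_integral_le: "(\<integral>\<omega>. (\<integral>t. H t \<omega> \<partial>\<mu>) \<partial>M) \<le> b * measure \<mu> (space \<mu>)"
proof -
  interpret PS: pair_sigma_finite \<mu> M ..
  have case_H: "case_prod H = (\<lambda>x. H (fst x) (snd x))" by (simp add: fun_eq_iff)
  have meas': "case_prod H \<in> borel_measurable (\<mu> \<Otimes>\<^sub>M M)" using meas by (simp add: case_H)
  have "(\<lambda>t. \<integral>\<omega>. H t \<omega> \<partial>M) \<in> borel_measurable \<mu>"
    by (rule P.borel_measurable_lebesgue_integral[OF meas'])
  then have intM: "integrable \<mu> (\<lambda>t. \<integral>\<omega>. H t \<omega> \<partial>M)"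
    by (rule Bochner_Integration.integrable_bound[OF integrable_const[of b]])
       (use bound nonneg in \<open>auto simp: space_\<mu> intro!: AE_I2 order_trans[OF _ abs_ge_self]\<close>)
  have pair: "integrable (\<mu> \<Otimes>\<^sub>M M) (case_prod H)"
    by (rule PS.Fubini_integrable[OF meas']) (use intM nonneg int in \<open>auto simp: space_\<mu>\<close>)
  show "integrable M (\<lambda>\<omega>. \<integral>t. H t \<omega> \<partial>\<mu>)" by (rule PS.integrable_snd[OF pair])
  have "(\<integral>\<omega>. (\<integral>t. H t \<omega> \<partial>\<mu>) \<partial>M) = (\<integral>t. (\<integral>\<omega>. H t \<omega> \<partial>M) \<partial>\<mu>)"
    by (rule PS.Fubini_integral[OF pair])
  also have "\<dots> \<le> (\<integral>t. b \<partial>\<mu>)"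
    by (rule integral_mono[OF intM integrable_const]) (simp add: bound space_\<mu>)
  finally show "(\<integral>\<omega>. (\<integral>t. H t \<omega> \<partial>\<mu>) \<partial>M) \<le> b * measure \<mu> (space \<mu>)"
    by (simp add: mult.commute)
qed

lemma exp_path_bounded:
  assumes "\<omega> \<in> space M"
  obtains B where "B \<ge> 0" "\<And>t. t \<in> {0..T} \<Longrightarrow> exp (c * \<bar>X t \<omega>\<bar>) \<le> B"
proof -
  obtain B where B: "B \<ge> 0" "\<And>t. t \<in> {0..T} \<Longrightarrow> \<bar>X t \<omega>\<bar> \<le> B"
    by (rule cadlag_bounded[OF P.X_cadlag[OF assms]]) blast
  have "exp (c * \<bar>X t \<omega>\<bar>) \<le> exp (\<bar>c\<bar> * B)" if "t \<in> {0..T}" for t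
  proof -
    have "c * \<bar>X t \<omega>\<bar> \<le> \<bar>c\<bar> * \<bar>X t \<omega>\<bar>" by (intro mult_right_mono) auto
    also have "\<dots> \<le> \<bar>c\<bar> * B" using B(2)[OF that] by (intro mult_left_mono) auto
    finally show ?thesis by simp
  qed
  then show ?thesis using that[of "exp (\<bar>c\<bar> * B)"] by simp
qed

text \<open>The time change \<open>d\<close> covers two cases: the identity and
  \<open>next_grid_point n\<close>. For the square, the norm is at most 1 plus a path integral;
  Cauchy-Schwarz over time moves the square under that integral, where it doubles the
  exponent.\<close>

lemma
  assumes d: "\<And>t. t \<in> {0..T} \<Longrightarrow> d t \<in> {0..T}"
    and meas: "(\<lambda>x. X (d (fst x)) (snd x)) \<in> borel_measurable (\<mu> \<Otimes>\<^sub>M M)"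
  shows exp_path_in_Lp: "\<omega> \<in> space M \<Longrightarrow> (\<lambda>t. exp (c * \<bar>X (d t) \<omega>\<bar>)) \<in> Lp \<mu> p"
    and exp_path_square: "\<omega> \<in> space M \<Longrightarrow> (Lp_norm \<mu> p (\<lambda>t. exp (c * \<bar>X (d t) \<omega>\<bar>)))\<^sup>2
      \<le> 2 + 2 * measure \<mu> (space \<mu>) * (\<integral>t. exp (2 * (p * c) * \<bar>X (d t) \<omega>\<bar>) \<partial>\<mu>)"
    and exp_path_integrable: "integrable M (\<lambda>\<omega>. \<integral>t. exp (c * \<bar>X (d t) \<omega>\<bar>) \<partial>\<mu>)"
proof -
  have path: "(\<lambda>t. exp (c * \<bar>X (d t) \<omega>\<bar>)) \<in> borel_measurable \<mu>" if "\<omega> \<in> space M" for \<omega> c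
  proof -
    have "(\<lambda>t. X (d t) \<omega>) \<in> borel_measurable \<mu>"
      using measurable_compose[OF measurable_Pair2'[OF that] meas] by simp
    then show ?thesis by measurable
  qed
  have bounded: "\<exists>B. \<forall>t\<in>{0..T}. \<bar>exp (c * \<bar>X (d t) \<omega>\<bar>)\<bar> \<le> B" if "\<omega> \<in> space M" for \<omega> c
    using exp_path_bounded[OF that, of c] d by (metis abs_exp_cancel)
  show "(\<lambda>t. exp (c * \<bar>X (d t) \<omega>\<bar>)) \<in> Lp \<mu> p" if "\<omega> \<in> space M"
    using bounded[OF that] bounded_in_Lp[OF path[OF that]] by blast
  show "integrable M (\<lambda>\<omega>. \<integral>t. exp (c * \<bar>X (d t) \<omega>\<bar>) \<partial>\<mu>)"
  proof -
    obtain b where b: "\<And>t. t \<in> {0..T} \<Longrightarrow> (\<integral>\<omega>. exp (c * \<bar>X t \<omega>\<bar>) \<partial>M) \<le> b"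
      by (rule P.exp_abs_moment_bounded[of c]) blast
    show ?thesis
    proof (rule integrable_path_integral)
      show "(\<lambda>x. exp (c * \<bar>X (d (fst x)) (snd x)\<bar>)) \<in> borel_measurable (\<mu> \<Otimes>\<^sub>M M)"
        using meas by measurable
    qed (use b d P.exp_abs_X_integrable in auto)
  qed
  show "(Lp_norm \<mu> p (\<lambda>t. exp (c * \<bar>X (d t) \<omega>\<bar>)))\<^sup>2
      \<le> 2 + 2 * measure \<mu> (space \<mu>) * (\<integral>t. exp (2 * (p * c) * \<bar>X (d t) \<omega>\<bar>) \<partial>\<mu>)"
    if \<omega>: "\<omega> \<in> space M"
  proof -
    let ?g = "\<lambda>t. exp (p * c * \<bar>X (d t) \<omega>\<bar>)"
    let ?I = "\<integral>t. ?g t \<partial>\<mu>"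
    have g2: "(?g t)\<^sup>2 = exp (2 * (p * c) * \<bar>X (d t) \<omega>\<bar>)" for t
      by (simp add: power2_eq_square exp_add[symmetric] algebra_simps)
    have powr_eq: "\<bar>exp (c * \<bar>X (d t) \<omega>\<bar>)\<bar> powr p = ?g t" for t
      by (simp add: powr_def mult_ac)
    have int2: "integrable \<mu> (\<lambda>t. (?g t)\<^sup>2)"
    proof -
      obtain B where B: "\<forall>t\<in>{0..T}. \<bar>exp (2 * (p * c) * \<bar>X (d t) \<omega>\<bar>)\<bar> \<le> B"
        using bounded[OF \<omega>] by blast
      have "norm (exp (2 * (p * c) * \<bar>X (d t) \<omega>\<bar>)) \<le> norm B" if "t \<in> space \<mu>" for t
        using bspec[OF B that[unfolded space_\<mu>]] unfolding real_norm_def by linarith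
      then show ?thesis
        unfolding g2
        by (intro Bochner_Integration.integrable_bound[OF integrable_const[of B]] path \<omega> AE_I2)
    qed
    have "0 \<le> Lp_norm \<mu> p (\<lambda>t. exp (c * \<bar>X (d t) \<omega>\<bar>))" by (rule Lp_norm_nonneg)
    moreover have "Lp_norm \<mu> p (\<lambda>t. exp (c * \<bar>X (d t) \<omega>\<bar>)) \<le> 1 + ?I"
      using Lp_norm_le[of "\<lambda>t. exp (c * \<bar>X (d t) \<omega>\<bar>)"] unfolding powr_eq .
    ultimately have "(Lp_norm \<mu> p (\<lambda>t. exp (c * \<bar>X (d t) \<omega>\<bar>)))\<^sup>2 \<le> (1 + ?I)\<^sup>2" by (rule power_mono[rotated])
    also have "\<dots> \<le> 2 + 2 * ?I\<^sup>2"
      using zero_le_power2[of "1 - ?I"] by (simp add: power2_eq_square algebra_simps)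
    also have "?I\<^sup>2 \<le> measure \<mu> (space \<mu>) * (\<integral>t. (?g t)\<^sup>2 \<partial>\<mu>)"
      by (rule square_integral_le(2)[OF path[OF \<omega>] int2])
    finally show ?thesis unfolding g2 by (simp add: mult_ac)
  qed
qed

section \<open>Convergence of the discretized expectations\<close>

definition Z_grid :: "nat \<Rightarrow> real \<Rightarrow> 'w \<Rightarrow> real \<Rightarrow> real" where
  "Z_grid n \<sigma> \<omega> t = Z \<sigma> \<omega> (next_grid_point n t)"

lemma Z_grid_cadlag: "Z_grid n \<sigma> \<omega> \<in> cadlag T"
  unfolding Z_grid_def[abs_def] next_grid_point_def
  by (rule step_function_cadlag[of "\<lambda>i. Z \<sigma> \<omega> (grid_point T n i)"])

text \<open>The sampled path has finitely many relevant values, and \<open>F\<close> is a Lipschitz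
  function of them. Measurability along the full path is inherited from this in the limit.\<close>

lemma F_grid_measurable: "(\<lambda>\<omega>. F (Z_grid n \<sigma> \<omega>)) \<in> borel_measurable M"
proof -
  interpret S: coordinate_lipschitz "\<lambda>y. F (\<lambda>t. y (grid_index n t))" "\<bar>C\<bar> * mass" "grid_index n T"
    by (rule step_coordinate_lipschitz)
  show ?thesis
    unfolding Z_grid_def[abs_def] next_grid_point_def
  proof (rule S.\<Phi>_measurable[of "\<lambda>\<omega> i. Z \<sigma> \<omega> (grid_point T n i)"])
    show "(\<lambda>\<omega>. Z \<sigma> \<omega> (grid_point T n i)) \<in> borel_measurable M" for i
      unfolding P.normalized_exp_eq[OF grid_point_in[OF T_pos]]
      using P.X_measurable[OF grid_point_in[OF T_pos]] by measurable
  qed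
qed

lemma F_grid_limit:
  assumes \<omega>: "\<omega> \<in> space M"
  shows "(\<lambda>n. F (Z_grid n \<sigma> \<omega>)) \<longlonglongrightarrow> F (Z \<sigma> \<omega>)"
proof -
  have Z: "Z \<sigma> \<omega> \<in> cadlag T" by (rule P.normalized_exp_cadlag[OF \<omega>])
  obtain B where B: "\<And>t. t \<in> {0..T} \<Longrightarrow> \<bar>Z \<sigma> \<omega> t\<bar> \<le> B" by (rule cadlag_bounded[OF Z]) blast
  have "(\<lambda>n. Lp_norm \<mu> p (\<lambda>t. Z_grid n \<sigma> \<omega> t - Z \<sigma> \<omega> t)) \<longlonglongrightarrow> 0"
  proof (rule Lp_norm_tendsto_0)
    show "(\<lambda>t. Z_grid n \<sigma> \<omega> t - Z \<sigma> \<omega> t) \<in> borel_measurable \<mu>" for n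
      by (intro borel_measurable_diff cadlag_measurable Z Z_grid_cadlag)
    show "\<bar>Z_grid n \<sigma> \<omega> t - Z \<sigma> \<omega> t\<bar> \<le> B + B" if "t \<in> {0..T}" for n t
      using B[OF that] B[OF next_grid_point_in[of n t]] unfolding Z_grid_def by linarith
    show "(\<lambda>n. Z_grid n \<sigma> \<omega> t - Z \<sigma> \<omega> t) \<longlonglongrightarrow> 0" if "t \<in> {0..T}" for t
      unfolding Z_grid_def next_grid_point_def by (intro LIM_zero cadlag_grid_limit[OF Z that])
  qed
  then have "(\<lambda>n. \<bar>C\<bar> * Lp_norm \<mu> p (\<lambda>t. Z_grid n \<sigma> \<omega> t - Z \<sigma> \<omega> t)) \<longlonglongrightarrow> 0"
    by (rule tendsto_mult_right_zero)
  moreover have "norm (F (Z_grid n \<sigma> \<omega>) - F (Z \<sigma> \<omega>))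
      \<le> \<bar>C\<bar> * Lp_norm \<mu> p (\<lambda>t. Z_grid n \<sigma> \<omega> t - Z \<sigma> \<omega> t)" for n
    using F_lipschitz[OF Z_grid_cadlag Z] by simp
  ultimately have "(\<lambda>n. F (Z_grid n \<sigma> \<omega>) - F (Z \<sigma> \<omega>)) \<longlonglongrightarrow> 0"
    by (rule Lim_null_comparison[OF eventuallyI, rotated])
  then show ?thesis by (simp add: LIM_zero_iff)
qed

lemma
  shows F_normalized_exp_integrable: "integrable M (\<lambda>\<omega>. F (Z \<sigma> \<omega>))"
    and expectation_F_grid_limit: "(\<lambda>n. \<integral>\<omega>. F (Z_grid n \<sigma> \<omega>) \<partial>M) \<longlonglongrightarrow> (\<integral>\<omega>. F (Z \<sigma> \<omega>) \<partial>M)"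
proof -
  obtain K where K: "K \<ge> 0" "\<And>t \<omega>. t \<in> {0..T} \<Longrightarrow> \<bar>Z \<sigma> \<omega> t\<bar> \<le> K * exp (\<bar>\<sigma>\<bar> * \<bar>X t \<omega>\<bar>)"
    by (rule P.normalized_exp_bound) blast
  let ?c = "2 * (p * \<bar>\<sigma>\<bar>)" and ?m = "measure \<mu> (space \<mu>)"
  define R where "R n \<omega> = (\<integral>t. exp (?c * \<bar>X (next_grid_point n t) \<omega>\<bar>) \<partial>\<mu>)" for n \<omega>
  obtain b where b: "\<And>t. t \<in> {0..T} \<Longrightarrow> (\<integral>\<omega>. exp (?c * \<bar>X t \<omega>\<bar>) \<partial>M) \<le> b"
    by (rule P.exp_abs_moment_bounded[of ?c]) blast
  have R_int: "integrable M (R n)" for n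
    unfolding R_def by (rule exp_path_integrable[OF next_grid_point_in X_grid_measurable])
  have R_le: "(\<integral>\<omega>. R n \<omega> \<partial>M) \<le> b * ?m" for n
    unfolding R_def
  proof (rule path_integral_le)
    show "(\<lambda>x. exp (?c * \<bar>X (next_grid_point n (fst x)) (snd x)\<bar>)) \<in> borel_measurable (\<mu> \<Otimes>\<^sub>M M)"
      using X_grid_measurable[of n] by measurable
  qed (use b next_grid_point_in P.exp_abs_X_integrable in auto)
  \<comment> \<open>Both constants come from the linear growth of \<open>F\<close>, squared with (x
    + y)^2 <= 2 x^2 + 2 y^2, once \<open>exp_path_square\<close> has replaced the squared norm by
    \<open>2 + 2 * ?m * R n \<omega>\<close>.\<close>
  define k where "k = 2 * (F (\<lambda>_. 0))\<^sup>2 + 4 * (\<bar>C\<bar> * K)\<^sup>2"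
  define k' where "k' = 4 * (\<bar>C\<bar> * K)\<^sup>2 * ?m"
  have F_sq: "(F (Z_grid n \<sigma> \<omega>))\<^sup>2 \<le> k + k' * R n \<omega>" if \<omega>: "\<omega> \<in> space M" for n \<omega>
  proof -
    let ?h = "\<lambda>t. exp (\<bar>\<sigma>\<bar> * \<bar>X (next_grid_point n t) \<omega>\<bar>)"
    have h: "?h \<in> Lp \<mu> p" by (rule exp_path_in_Lp[OF next_grid_point_in X_grid_measurable \<omega>])
    have Kh: "(\<lambda>t. K * ?h t) \<in> Lp \<mu> p" by (rule Lp_cmult[OF h])
    have "Lp_norm \<mu> p (Z_grid n \<sigma> \<omega>) \<le> Lp_norm \<mu> p (\<lambda>t. K * ?h t)"
      by (rule Lp_norm_mono[OF cadlag_measurable[OF Z_grid_cadlag] _ Kh])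
         (unfold Z_grid_def, rule K(2)[OF next_grid_point_in])
    also have "\<dots> = K * Lp_norm \<mu> p ?h" using K(1) by (simp add: Lp_norm_cmult)
    finally have "\<bar>C\<bar> * Lp_norm \<mu> p (Z_grid n \<sigma> \<omega>) \<le> \<bar>C\<bar> * (K * Lp_norm \<mu> p ?h)"
      by (rule mult_left_mono) simp
    then have "\<bar>F (Z_grid n \<sigma> \<omega>)\<bar> \<le> \<bar>F (\<lambda>_. 0)\<bar> + \<bar>C\<bar> * K * Lp_norm \<mu> p ?h"
      using F_growth[OF Z_grid_cadlag[of n \<sigma> \<omega>]] by (simp add: mult.assoc)
    then have "\<bar>F (Z_grid n \<sigma> \<omega>)\<bar>\<^sup>2 \<le> (\<bar>F (\<lambda>_. 0)\<bar> + \<bar>C\<bar> * K * Lp_norm \<mu> p ?h)\<^sup>2"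
      by (rule power_mono) simp
    also have "\<dots> \<le> 2 * \<bar>F (\<lambda>_. 0)\<bar>\<^sup>2 + 2 * (\<bar>C\<bar> * K * Lp_norm \<mu> p ?h)\<^sup>2"
      using zero_le_power2[of "\<bar>F (\<lambda>_. 0)\<bar> - \<bar>C\<bar> * K * Lp_norm \<mu> p ?h"]
      by (simp only: power2_diff power2_sum)
    also have "\<dots> = 2 * (F (\<lambda>_. 0))\<^sup>2 + 2 * (\<bar>C\<bar> * K)\<^sup>2 * (Lp_norm \<mu> p ?h)\<^sup>2"
      by (simp add: power_mult_distrib)
    also have "\<dots> \<le> 2 * (F (\<lambda>_. 0))\<^sup>2 + 2 * (\<bar>C\<bar> * K)\<^sup>2 * (2 + 2 * ?m * R n \<omega>)"
      unfolding R_def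
      by (intro add_left_mono mult_left_mono exp_path_square[OF next_grid_point_in X_grid_measurable \<omega>]) auto
    also have "\<dots> = k + k' * R n \<omega>" by (simp add: k_def k'_def algebra_simps)
    finally show ?thesis by simp
  qed
  have bound_int: "integrable M (\<lambda>\<omega>. k + k' * R n \<omega>)" for n using R_int by simp
  have sq_int: "integrable M (\<lambda>\<omega>. (F (Z_grid n \<sigma> \<omega>))\<^sup>2)" for n
  proof (rule Bochner_Integration.integrable_bound[OF bound_int[of n]])
    show "(\<lambda>\<omega>. (F (Z_grid n \<sigma> \<omega>))\<^sup>2) \<in> borel_measurable M" using F_grid_measurable by measurable
    show "AE \<omega> in M. norm ((F (Z_grid n \<sigma> \<omega>))\<^sup>2) \<le> norm (k + k' * R n \<omega>)"
      using F_sq[THEN order_trans, OF _ abs_ge_self] by (intro AE_I2) (simp only: real_norm_def abs_power2)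
  qed
  have sq_le: "(\<integral>\<omega>. (F (Z_grid n \<sigma> \<omega>))\<^sup>2 \<partial>M) \<le> k + k' * (b * ?m)" for n
  proof -
    have "(\<integral>\<omega>. (F (Z_grid n \<sigma> \<omega>))\<^sup>2 \<partial>M) \<le> (\<integral>\<omega>. k + k' * R n \<omega> \<partial>M)"
      by (rule integral_mono[OF sq_int bound_int F_sq])
    also have "\<dots> = k + k' * (\<integral>\<omega>. R n \<omega> \<partial>M)"
      using R_int by (simp add: P.prob_space)
    also have "\<dots> \<le> k + k' * (b * ?m)"
      using R_le by (intro add_left_mono mult_left_mono) (auto simp: k'_def)
    finally show ?thesis .
  qed
  show "integrable M (\<lambda>\<omega>. F (Z \<sigma> \<omega>))"
    by (rule P.integrable_limit_bounded_L2[OF F_grid_measurable F_grid_limit sq_int sq_le])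
  show "(\<lambda>n. \<integral>\<omega>. F (Z_grid n \<sigma> \<omega>) \<partial>M) \<longlonglongrightarrow> (\<integral>\<omega>. F (Z \<sigma> \<omega>) \<partial>M)"
    by (rule P.integral_limit_bounded_L2[OF F_grid_measurable F_grid_limit sq_int sq_le])
qed

section \<open>Monotonicity and differentiability of the expectation\<close>

lemma expectation_F_mono:
  assumes mono: "nondecreasing_gradient T G" and \<sigma>: "0 \<le> \<sigma>" "\<sigma> < \<sigma>'"
  shows "(\<integral>\<omega>. F (Z \<sigma> \<omega>) \<partial>M) \<le> (\<integral>\<omega>. F (Z \<sigma>' \<omega>) \<partial>M)"
proof (rule LIMSEQ_le[OF expectation_F_grid_limit expectation_F_grid_limit])
  have "(\<integral>\<omega>. F (Z_grid n \<sigma> \<omega>) \<partial>M) \<le> (\<integral>\<omega>. F (Z_grid n \<sigma>' \<omega>) \<partial>M)" for n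
  proof -
    let ?\<tau> = "grid_point T n"
    note \<tau> = grid_point_in[OF T_pos, of n] grid_point_mono[of _ _ T n]
    interpret D: independent_exponentials M "P.increment ?\<tau>"
      by (rule P.increments_exponentials[OF \<tau>])
    interpret S: directionally_convex "\<lambda>y. F (\<lambda>t. y (grid_index n t))" "\<bar>C\<bar> * mass" "grid_index n T"
      "\<lambda>y b w. \<integral>s. G s (\<lambda>t. y (grid_index n t) + w * b (grid_index n t)) * b (grid_index n s) \<partial>\<mu>"
      by (rule step_directionally_convex[OF mono])
    interpret E: convex_in_exponentials M "P.increment ?\<tau>" "\<lambda>y. F (\<lambda>t. y (grid_index n t))"
      "\<bar>C\<bar> * mass" "grid_index n T"
      "\<lambda>y b w. \<integral>s. G s (\<lambda>t. y (grid_index n t) + w * b (grid_index n t)) * b (grid_index n s) \<partial>\<mu>" ..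
    have Y_eq: "D.Y (\<lambda>_. u) i (\<lambda>k. P.increment ?\<tau> k \<omega>) = Z u \<omega> (?\<tau> i)" for u i \<omega>
      by (rule P.normalized_exp_product[OF \<tau>])
    show ?thesis
      using E.expectation_mono[OF \<sigma>]
      unfolding Y_eq Z_grid_def[abs_def] next_grid_point_def .
  qed
  then show "\<exists>N. \<forall>n\<ge>N. (\<integral>\<omega>. F (Z_grid n \<sigma> \<omega>) \<partial>M) \<le> (\<integral>\<omega>. F (Z_grid n \<sigma>' \<omega>) \<partial>M)" by blast
qed

lemma expectation_F_has_real_derivative:
  "\<exists>D. ((\<lambda>v. \<integral>\<omega>. F (Z v \<omega>) \<partial>M) has_real_derivative D) (at \<sigma>)"
proof -
  let ?c = "\<bar>\<sigma>\<bar> + 2"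
  obtain \<delta> K where \<delta>: "\<delta> > 0" and K: "K \<ge> 0"
    and lip: "\<And>v t \<omega>. \<bar>v - \<sigma>\<bar> < \<delta> \<Longrightarrow> t \<in> {0..T} \<Longrightarrow>
      \<bar>Z v \<omega> t - Z \<sigma> \<omega> t\<bar> \<le> \<bar>v - \<sigma>\<bar> * (K * exp (?c * \<bar>X t \<omega>\<bar>))"
    by (rule P.normalized_exp_Lipschitz) blast
  have "\<forall>\<omega> t. \<exists>d. t \<in> {0..T} \<longrightarrow> ((\<lambda>v. Z v \<omega> t) has_real_derivative d) (at \<sigma>)"
    using P.normalized_exp_has_real_derivative by blast
  then obtain Z' where Z': "\<And>\<omega> t. t \<in> {0..T} \<Longrightarrow> ((\<lambda>v. Z v \<omega> t) has_real_derivative Z' \<omega> t) (at \<sigma>)"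
    by metis
  \<comment> \<open>\<open>C\<close> bounds the increments of \<open>F\<close>, \<open>K\<close>
    those of the normalized exponential, and the last factor bounds the L^p norm of
    \<open>exp (?c * \<bar>X t \<omega>\<bar>)\<close> through \<open>Lp_norm_le\<close>, whence the
    \<open>p\<close> in the exponent.\<close>
  define B where "B \<omega> = \<bar>C\<bar> * K * (1 + (\<integral>t. exp (p * ?c * \<bar>X t \<omega>\<bar>) \<partial>\<mu>))" for \<omega>
  have "((\<lambda>v. \<integral>\<omega>. F (Z v \<omega>) \<partial>M) has_real_derivative (\<integral>\<omega>. (\<integral>s. G s (Z \<sigma> \<omega>) * Z' \<omega> s \<partial>\<mu>) \<partial>M)) (at \<sigma>)"
  proof (rule has_real_derivative_integral[OF \<delta>])
    show "integrable M (\<lambda>\<omega>. F (Z v \<omega>))" for v by (rule F_normalized_exp_integrable)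
    show "integrable M B"
      unfolding B_def using exp_path_integrable[where d = "\<lambda>t. t", OF _ X_measurable_pair] by simp
    fix \<omega> assume \<omega>: "\<omega> \<in> space M"
    show "((\<lambda>v. F (Z v \<omega>)) has_real_derivative (\<integral>s. G s (Z \<sigma> \<omega>) * Z' \<omega> s \<partial>\<mu>)) (at \<sigma>)"
    proof -
      obtain b where b: "b \<ge> 0" "\<And>t. t \<in> {0..T} \<Longrightarrow> exp (?c * \<bar>X t \<omega>\<bar>) \<le> b"
        by (rule exp_path_bounded[OF \<omega>, of ?c]) blast
      show ?thesis
      proof (rule F_path_has_real_derivative[OF \<delta>])
        show "0 \<le> K * b" using K b(1) by simp
        fix v s assume v: "\<bar>v - \<sigma>\<bar> < \<delta>" and s: "s \<in> {0..T}"
        have "\<bar>v - \<sigma>\<bar> * (K * exp (?c * \<bar>X s \<omega>\<bar>)) \<le> \<bar>v - \<sigma>\<bar> * (K * b)"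
          using K b(2)[OF s] by (intro mult_left_mono) auto
        with lip[OF v s] show "\<bar>Z v \<omega> s - Z \<sigma> \<omega> s\<bar> \<le> \<bar>v - \<sigma>\<bar> * (K * b)" by (rule order_trans)
      qed (use P.normalized_exp_cadlag[OF \<omega>] Z' in auto)
    qed
    fix v assume v: "\<bar>v - \<sigma>\<bar> < \<delta>"
    let ?h = "\<lambda>t. exp (?c * \<bar>X t \<omega>\<bar>)" and ?k = "\<bar>v - \<sigma>\<bar> * K"
    have Zv: "Z v \<omega> \<in> cadlag T" for v by (rule P.normalized_exp_cadlag[OF \<omega>])
    have "?h \<in> Lp \<mu> p" by (rule exp_path_in_Lp[where d = "\<lambda>t. t", OF _ X_measurable_pair \<omega>])
    then have kh: "(\<lambda>t. ?k * ?h t) \<in> Lp \<mu> p" by (rule Lp_cmult)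
    have powr_eq: "\<bar>?h t\<bar> powr p = exp (p * ?c * \<bar>X t \<omega>\<bar>)" for t by (simp add: powr_def mult_ac)
    have "Lp_norm \<mu> p (\<lambda>t. Z v \<omega> t - Z \<sigma> \<omega> t) \<le> Lp_norm \<mu> p (\<lambda>t. ?k * ?h t)"
      using lip[OF v] by (intro Lp_norm_mono kh borel_measurable_diff cadlag_measurable Zv) (simp add: mult.assoc)
    also have "\<dots> = ?k * Lp_norm \<mu> p ?h" using K by (simp add: Lp_norm_cmult)
    also have "\<dots> \<le> ?k * (1 + (\<integral>t. exp (p * ?c * \<bar>X t \<omega>\<bar>) \<partial>\<mu>))"
      using Lp_norm_le[of ?h] K unfolding powr_eq by (intro mult_left_mono) auto
    finally have "\<bar>C\<bar> * Lp_norm \<mu> p (\<lambda>t. Z v \<omega> t - Z \<sigma> \<omega> t)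
        \<le> \<bar>C\<bar> * (?k * (1 + (\<integral>t. exp (p * ?c * \<bar>X t \<omega>\<bar>) \<partial>\<mu>)))"
      by (rule mult_left_mono) simp
    with F_lipschitz[OF Zv Zv, of v \<sigma>]
    show "\<bar>F (Z v \<omega>) - F (Z \<sigma> \<omega>)\<bar> \<le> \<bar>v - \<sigma>\<bar> * B \<omega>"
      unfolding B_def by (simp only: mult_ac)
  qed
  then show ?thesis by blast
qed

lemma process_functional_uminus:
  "process_functional \<mu> T p (\<lambda>\<alpha>. - F \<alpha>) (\<lambda>s \<alpha>. - G s \<alpha>) C M X"
proof
  fix \<alpha> \<beta> assume c: "\<alpha> \<in> cadlag T" "\<beta> \<in> cadlag T"
  show "\<bar>- F \<alpha> - - F \<beta>\<bar> \<le> C * Lp_norm \<mu> p (\<lambda>s. \<alpha> s - \<beta> s)"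
    using F_lipschitz'[OF c] by simp
next
  fix \<alpha> assume \<alpha>: "\<alpha> \<in> cadlag T"
  show "(\<lambda>s. - G s \<alpha>) \<in> Lp_conj \<mu> p"
    using gradient_Lp[OF \<alpha>] by (auto simp: Lp_conj_def Lp_def)
  have "\<bar>- F (\<lambda>s. \<alpha> s + h s) - - F \<alpha> - (\<integral>s. - G s \<alpha> * h s \<partial>\<mu>)\<bar>
      = \<bar>F (\<lambda>s. \<alpha> s + h s) - F \<alpha> - (\<integral>s. G s \<alpha> * h s \<partial>\<mu>)\<bar>" for h
    by (simp add: abs_if)
  then show "((\<lambda>h. \<bar>- F (\<lambda>s. \<alpha> s + h s) - - F \<alpha> - (\<integral>s. - G s \<alpha> * h s \<partial>\<mu>)\<bar> / Lp_norm \<mu> p h)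
        \<longlongrightarrow> 0) (Lp_to_zero \<mu> p)"
    using gradient[OF \<alpha>] by simp
qed

end

theorem proposition6p2:
  fixes T p C :: real
    and \<mu> :: "real measure"
    and M :: "'w measure"
    and X :: "real \<Rightarrow> 'w \<Rightarrow> real"
    and F :: "(real \<Rightarrow> real) \<Rightarrow> real"
    and G :: "real \<Rightarrow> (real \<Rightarrow> real) \<Rightarrow> real"
    and f :: "real \<Rightarrow> real"
  assumes "T > 0"
    and "sets \<mu> = sets (restrict_space borel {0..T})"
    and "finite_measure \<mu>"
    and "p \<ge> 1"
    and "prob_space M"
    and "cadlag_process M T X"
    and "independent_increments M T X"
    and "\<And>u t. t \<in> {0..T} \<Longrightarrow> integrable M (\<lambda>\<omega>. exp (u * X t \<omega>))"
    and "\<And>u. \<exists>a b. 0 < a \<and> (\<forall>t\<in>{0..T}. a \<le> exp_moment M X u t \<and> exp_moment M X u t \<le> b)"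
    and "F \<in> borel_measurable (Lp_borel \<mu> p)"
    and "regularly_differentiable \<mu> T p F G"
    and "monotone_gradient T G"
    and "\<And>\<alpha> \<beta>. \<alpha> \<in> cadlag T \<Longrightarrow> \<beta> \<in> cadlag T \<Longrightarrow>
           \<bar>F \<alpha> - F \<beta>\<bar> \<le> C * Lp_norm \<mu> p (\<lambda>s. \<alpha> s - \<beta> s)"
    and "\<And>\<sigma>. \<sigma> > 0 \<Longrightarrow> f \<sigma> = (\<integral>\<omega>. F (normalized_exp M X \<sigma> \<omega>) \<partial>M)"
  shows "(\<forall>\<sigma>>0. integrable M (\<lambda>\<omega>. F (normalized_exp M X \<sigma> \<omega>))) \<and>
         (\<forall>\<sigma>>0. f differentiable (at \<sigma>)) \<and>
         (nondecreasing_gradient T G \<longrightarrow> mono_on {0<..} f) \<and>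
         (nonincreasing_gradient T G \<longrightarrow> antimono_on {0<..} f)"
proof (intro conjI allI impI)
  have diff: "\<forall>\<alpha>\<in>cadlag T. (\<lambda>s. G s \<alpha>) \<in> Lp_conj \<mu> p \<and>
      ((\<lambda>h. \<bar>F (\<lambda>s. \<alpha> s + h s) - F \<alpha> - (\<integral>s. G s \<alpha> * h s \<partial>\<mu>)\<bar> / Lp_norm \<mu> p h)
        \<longlongrightarrow> 0) (Lp_to_zero \<mu> p)"
    using assms(11) unfolding regularly_differentiable_def by (rule conjunct2)
  interpret finite_measure \<mu> by fact
  interpret PM: prob_space M by fact
  interpret process_functional \<mu> T p F G C M X
    by unfold_locales (use assms(1-9,13) diff in auto)
  show "integrable M (\<lambda>\<omega>. F (normalized_exp M X \<sigma> \<omega>))" for \<sigma> by (rule F_normalized_exp_integrable)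
  show "f differentiable (at \<sigma>)" if "\<sigma> > 0" for \<sigma>
  proof -
    obtain D where "((\<lambda>v. \<integral>\<omega>. F (normalized_exp M X v \<omega>) \<partial>M) has_real_derivative D) (at \<sigma>)"
      using expectation_F_has_real_derivative by blast
    then have "(f has_real_derivative D) (at \<sigma>)"
      \<comment> \<open>\<open>f\<close> is prescribed at positive arguments only, so the derivative
        is transferred on an open set.\<close>
      by (rule has_field_derivative_transform_within_open[where S = "{0<..}"])
         (use that assms(14) in auto)
    then show ?thesis by (auto simp: real_differentiable_def)
  qed
  show "mono_on {0<..} f" if "nondecreasing_gradient T G"
  proof (rule mono_onI)
    fix r s :: real assume "r \<in> {0<..}" "s \<in> {0<..}" "r \<le> s"
    then show "f r \<le> f s"
      using expectation_F_mono[OF that, of r s] assms(14) by (cases "r = s") auto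
  qed
  show "antimono_on {0<..} f" if "nonincreasing_gradient T G"
  proof (rule monotone_onI)
    interpret N: process_functional \<mu> T p "\<lambda>\<alpha>. - F \<alpha>" "\<lambda>s \<alpha>. - G s \<alpha>" C M X
      by (rule process_functional_uminus)
    have mono: "nondecreasing_gradient T (\<lambda>s \<alpha>. - G s \<alpha>)"
      using that by (simp add: nondecreasing_gradient_def nonincreasing_gradient_def)
    fix r s :: real assume "r \<in> {0<..}" "s \<in> {0<..}" "r \<le> s"
    then show "f r \<ge> f s"
      using N.expectation_F_mono[OF mono, of r s] assms(14) by (cases "r = s") auto
  qed
qed

end
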